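(* Let $F$ be an algebraically closed field of characteristic zero and let $R=UT_n(F)=\bigoplus_{g\in G}R_g$ be the algebra of $n\times n$ upper triangular matrices over $F$, graded by a finite abelian group $G$. Suppose $R$ is endowed with a degree-inverting involution $*$. Then $R$, as a graded algebra with involution, is isomorphic to $UT_n(F)$ with an elementary $G$-grading defined by an $n$-tuple $(g_1,\dots,g_n)\in G^n$ such that \[g_1^{-1}g_n=g_2^{-1}g_{n-1}=\cdots=g_n^{-1}g_1\] and with the involution $\circ$ or $s$. The involution $s$ can occur only if $n$ is even.
   Context: Involutions are $F$-linear: an involution on an algebra $A$ is a linear map $*:A\to A$ with $(ab)^*=b^*a^*$ and $(a^* )^*=a$. An involution $*$ on a $G$-graded algebra $A=\bigoplus_{g\in G}A_g$ is degree-inverting if $(A_g)^*\subseteq A_{g^{-1}}$ for all $g\in G$. An isomorphism of graded algebras with involution is an algebra isomorphism which preserves degrees and commutes with the involutions. The elementary grading on $UT_n(F)$ defined by $(g_1,\dots,g_n)\in G^n$ is the $G$-grading in which each matrix unit $e_{ij}$ ($i\le j$) is homogeneous of degree $g_i^{-1}g_j$. The involution $\circ$ on $UT_n(F)$ is $A^\circ=SA^tS$ with $S=\sum_{i=1}^n e_{i,n+1-i}$ (reflection along the secondary diagonal). For $n=2m$ even, the involution $s$ on $UT_n(F)$ is $A^s=JA^\circ J$ with $J=\begin{pmatrix}I_m&0\\0&-I_m\end{pmatrix}$. *)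

theory Defs
  imports
    "Jordan_Normal_Form.Matrix"
    "HOL-Computational_Algebra.Fundamental_Theorem_Algebra"
begin

text \<open>Rows and columns are indexed from \<open>0\<close>, so the index \<open>n + 1 - i\<close> of the usual convention
  becomes \<open>n - 1 - i\<close>, and \<open>(g\<^sub>1, \<dots>, g\<^sub>n)\<close> is a function on \<open>{..<n}\<close>.\<close>

definition UT :: "nat \<Rightarrow> 'a::field mat set" where
  "UT n = {A \<in> carrier_mat n n. upper_triangular A}"

definition UT_linear :: "nat \<Rightarrow> ('a::field mat \<Rightarrow> 'a mat) \<Rightarrow> bool" where
  "UT_linear n f \<longleftrightarrow>
     (\<forall>A\<in>UT n. \<forall>B\<in>UT n. f (A + B) = f A + f B) \<and>
     (\<forall>c. \<forall>A\<in>UT n. f (c \<cdot>\<^sub>m A) = c \<cdot>\<^sub>m f A)"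

text \<open>A family \<open>R\<close> is only meaningful on \<open>carrier G\<close>. The middle conjunct is the direct sum
  decomposition. \<open>finsum\<close> is \<open>0\<close> over an infinite index set, so it has this meaning only when
  \<open>carrier G\<close> is finite.\<close>

definition UT_grading ::
    "('g, 'm) monoid_scheme \<Rightarrow> nat \<Rightarrow> ('g \<Rightarrow> 'a::field mat set) \<Rightarrow> bool" where
  "UT_grading G n R \<longleftrightarrow>
     (\<forall>g\<in>carrier G. R g \<subseteq> UT n \<and> 0\<^sub>m n n \<in> R g \<and>
        (\<forall>A\<in>R g. \<forall>B\<in>R g. A + B \<in> R g) \<and> (\<forall>c. \<forall>A\<in>R g. c \<cdot>\<^sub>m A \<in> R g)) \<and>
     (\<forall>A\<in>UT n. \<exists>!a. a \<in> (\<Pi>\<^sub>E g\<in>carrier G. R g) \<and>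
        finsum (module_mat TYPE('a) n n) a (carrier G) = A) \<and>
     (\<forall>g\<in>carrier G. \<forall>h\<in>carrier G. \<forall>A\<in>R g. \<forall>B\<in>R h. A * B \<in> R (g \<otimes>\<^bsub>G\<^esub> h))"

definition mat_unit :: "nat \<Rightarrow> nat \<Rightarrow> nat \<Rightarrow> 'a::field mat" where
  "mat_unit n i j = mat n n (\<lambda>(k, l). if k = i \<and> l = j then 1 else 0)"

text \<open>This determines \<open>R\<close> uniquely on \<open>carrier G\<close>, since the matrix units \<open>e\<^sub>i\<^sub>j\<close> with
  \<open>i \<le> j\<close> form a basis of \<open>UT n\<close>.\<close>

definition elementary_grading ::
    "('g, 'm) monoid_scheme \<Rightarrow> nat \<Rightarrow> (nat \<Rightarrow> 'g) \<Rightarrow> ('g \<Rightarrow> 'a::field mat set) \<Rightarrow> bool" where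
  "elementary_grading G n g R \<longleftrightarrow>
     UT_grading G n R \<and>
     (\<forall>j<n. \<forall>i\<le>j. mat_unit n i j \<in> R (inv\<^bsub>G\<^esub> (g i) \<otimes>\<^bsub>G\<^esub> g j))"

definition UT_involution :: "nat \<Rightarrow> ('a::field mat \<Rightarrow> 'a mat) \<Rightarrow> bool" where
  "UT_involution n star \<longleftrightarrow>
     (\<forall>A\<in>UT n. star A \<in> UT n) \<and>
     UT_linear n star \<and>
     (\<forall>A\<in>UT n. \<forall>B\<in>UT n. star (A * B) = star B * star A) \<and>
     (\<forall>A\<in>UT n. star (star A) = A)"

definition degree_inverting ::
    "('g, 'm) monoid_scheme \<Rightarrow> ('g \<Rightarrow> 'a::field mat set) \<Rightarrow> ('a mat \<Rightarrow> 'a mat) \<Rightarrow> bool" where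
  "degree_inverting G R star \<longleftrightarrow> (\<forall>g\<in>carrier G. star ` R g \<subseteq> R (inv\<^bsub>G\<^esub> g))"

definition UT_graded_star_iso ::
    "('g, 'm) monoid_scheme \<Rightarrow> nat \<Rightarrow>
     ('g \<Rightarrow> 'a::field mat set) \<Rightarrow> ('a mat \<Rightarrow> 'a mat) \<Rightarrow>
     ('g \<Rightarrow> 'a mat set) \<Rightarrow> ('a mat \<Rightarrow> 'a mat) \<Rightarrow> ('a mat \<Rightarrow> 'a mat) \<Rightarrow> bool" where
  "UT_graded_star_iso G n R star R' star' \<phi> \<longleftrightarrow>
     bij_betw \<phi> (UT n) (UT n) \<and>
     UT_linear n \<phi> \<and>
     (\<forall>A\<in>UT n. \<forall>B\<in>UT n. \<phi> (A * B) = \<phi> A * \<phi> B) \<and>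
     (\<forall>g\<in>carrier G. \<phi> ` R g \<subseteq> R' g) \<and>
     (\<forall>A\<in>UT n. \<phi> (star A) = star' (\<phi> A))"

definition exchange_mat :: "nat \<Rightarrow> 'a::field mat" where
  "exchange_mat n = mat n n (\<lambda>(i, j). if j = n - 1 - i then 1 else 0)"

definition inv_circ :: "nat \<Rightarrow> 'a::field mat \<Rightarrow> 'a mat" where
  "inv_circ n A = exchange_mat n * transpose_mat A * exchange_mat n"

definition sign_mat :: "nat \<Rightarrow> 'a::field mat" where
  "sign_mat m = four_block_mat (1\<^sub>m m) (0\<^sub>m m m) (0\<^sub>m m m) (- 1\<^sub>m m)"

text \<open>The involution \<open>s\<close> on \<open>UT (2 * m)\<close>.\<close>

definition inv_s :: "nat \<Rightarrow> 'a::field mat \<Rightarrow> 'a mat" where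
  "inv_s m A = sign_mat m * inv_circ (2 * m) A * sign_mat m"

end

theory Submission
  imports Defs "Jordan_Normal_Form.Determinant"
begin

text \<open>The first row of \<open>UT n\<close>, and its subspaces of vectors supported in the last columns, can be
  described by annihilators of commutators. Since \<open>G\<close> is abelian, they are graded, so the space of
  row vectors has a homogeneous basis adapted to the standard flag, and in this basis the grading
  is elementary.

  An involution sends the idempotent \<open>e\<close> with index \<open>n - 1 - k\<close> to a conjugate \<open>f\<^sub>k\<close> of \<open>e\<^sub>k\<close>. The unipotent
  matrix \<open>t = \<Sum>k. f\<^sub>k e\<^sub>k\<close> has degree \<open>1\<close>, is symmetric, and satisfies \<open>f\<^sub>k t = t e\<^sub>k\<close>. Conjugating by
  the square root of \<open>t\<close> yields an involution that reverses the order of the diagonal idempotents.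
  It maps \<open>e\<^sub>i\<^sub>j\<close> to a multiple of the reflected matrix unit; the coefficients form a cocycle, and
  a diagonal conjugation trivialises it up to a sign.\<close>

section \<open>Upper triangular matrices\<close>

text \<open>The difficulty is to normalise the grading and the involution simultaneously: a
  conjugation that straightens the involution can spoil an elementary grading. Every conjugation
  after the first therefore uses matrices of degree \<open>\<one>\<close>, which fix the degrees of
  all matrix units, so one tuple \<open>d\<close> serves to the end. Degree inversion supplies these
  matrices: since \<open>\<one>\<close> is its own inverse, the involution preserves
  \<open>R \<one>\<close>, so the idempotents \<open>f k\<close>, the matrix \<open>t\<close> and
  its square root all lie there.

  The final sign has a simple origin. The cocycle has a potential \<open>weight\<close>, and a
  diagonal conjugation multiplies it at \<open>i\<close> by a factor that is the same at the
  reflected index. The ratio of the weights at opposite indices thus cannot be changed; it is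
  independent of the index and inverted by reflection, hence \<open>1\<close> or \<open>-1\<close>.
  These two values give the involutions \<open>\<circ>\<close> and \<open>s\<close>, and an index
  fixed by the reflection excludes \<open>-1\<close>, whence the parity condition.\<close>

lemma UT_iff:
  "A \<in> UT n \<longleftrightarrow> dim_row A = n \<and> dim_col A = n \<and> (\<forall>i<n. \<forall>j<i. A $$ (i,j) = 0)"
  by (auto simp: UT_def upper_triangular_def)

lemma UT_carrier: "A \<in> UT n \<Longrightarrow> A \<in> carrier_mat n n"
  by (simp add: UT_def)

lemma UT_dim: "A \<in> UT n \<Longrightarrow> dim_row A = n" "A \<in> UT n \<Longrightarrow> dim_col A = n"
  by (auto simp: UT_iff)

lemma UT_lower: "A \<in> UT n \<Longrightarrow> j < i \<Longrightarrow> i < n \<Longrightarrow> A $$ (i,j) = 0"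
  by (auto simp: UT_iff)

lemma UT_eqI:
  assumes "A \<in> UT n" "B \<in> UT n" "\<And>i j. i \<le> j \<Longrightarrow> j < n \<Longrightarrow> A $$ (i,j) = B $$ (i,j)"
  shows "A = B"
proof (rule eq_matI)
  fix i j assume "i < dim_row B" "j < dim_col B"
  then have "i < n" "j < n" using UT_dim[OF assms(2)] by simp_all
  then show "A $$ (i,j) = B $$ (i,j)"
    using assms(3)[of i j] UT_lower[OF assms(1), of j i] UT_lower[OF assms(2), of j i]
    by (cases "i \<le> j") simp_all
qed (simp_all add: UT_dim[OF assms(1)] UT_dim[OF assms(2)])

lemma mult_index:
  assumes "A \<in> carrier_mat n n" "B \<in> carrier_mat n n" "i < n" "j < n"
  shows "(A * B) $$ (i,j) = (\<Sum>k<n. A $$ (i,k) * B $$ (k,j))"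
  using assms by (auto simp: scalar_prod_def lessThan_atLeast0)

lemma UT_add: "A \<in> UT n \<Longrightarrow> B \<in> UT n \<Longrightarrow> A + B \<in> UT n"
  and UT_minus: "A \<in> UT n \<Longrightarrow> B \<in> UT n \<Longrightarrow> A - B \<in> UT n"
  and UT_smult: "A \<in> UT n \<Longrightarrow> c \<cdot>\<^sub>m A \<in> UT n"
  and UT_zero: "0\<^sub>m n n \<in> UT n"
  and UT_one: "1\<^sub>m n \<in> UT n"
  by (auto simp: UT_iff)

lemma UT_mult:
  assumes "A \<in> UT n" "B \<in> UT n" shows "A * B \<in> UT n"
  unfolding UT_iff
proof (intro conjI allI impI)
  fix i j assume ij: "i < n" "j < i"
  have "A $$ (i,k) * B $$ (k,j) = 0" if "k < n" for k
    using assms ij that by (cases "k < i") (auto simp: UT_lower)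
  then have "(\<Sum>k<n. A $$ (i,k) * B $$ (k,j)) = 0" by (intro sum.neutral) simp
  then show "(A * B) $$ (i,j) = 0"
    using assms ij by (simp add: mult_index[OF UT_carrier UT_carrier] del: index_mult_mat)
qed (use assms in \<open>auto simp: UT_iff\<close>)

lemmas UT_closed = UT_add UT_minus UT_smult UT_zero UT_one UT_mult

lemma UT_mult_assoc:
  "A \<in> UT n \<Longrightarrow> B \<in> UT n \<Longrightarrow> C \<in> UT n \<Longrightarrow> A * B * C = A * (B * C)"
  by (rule assoc_mult_mat[OF UT_carrier UT_carrier UT_carrier])

lemma UT_one_mult: "A \<in> UT n \<Longrightarrow> 1\<^sub>m n * A = A" "A \<in> UT n \<Longrightarrow> A * 1\<^sub>m n = A"
  by (auto dest: UT_carrier)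

lemma UT_mult_cancel:
  assumes "A \<in> UT n" "B \<in> UT n" "C \<in> UT n" "A * B = 1\<^sub>m n"
  shows "A * (B * C) = C"
  using assms by (metis UT_mult_assoc UT_one_mult(1))

lemma UT_mult_zero:
  "A \<in> UT n \<Longrightarrow> A * 0\<^sub>m n n = 0\<^sub>m n n" "A \<in> UT n \<Longrightarrow> 0\<^sub>m n n * A = 0\<^sub>m n n"
  by (auto dest: UT_carrier)

lemma UT_mult_index:
  assumes "A \<in> UT n" "B \<in> UT n" "i \<le> j" "j < n"
  shows "(A * B) $$ (i,j) = (\<Sum>k=i..j. A $$ (i,k) * B $$ (k,j))"
proof -
  have "(\<Sum>k<n. A $$ (i,k) * B $$ (k,j)) = (\<Sum>k=i..j. A $$ (i,k) * B $$ (k,j))"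
    using assms by (intro sum.mono_neutral_right) (auto simp: UT_lower not_le)
  then show ?thesis
    using assms by (simp add: mult_index[OF UT_carrier UT_carrier] del: index_mult_mat)
qed

lemma UT_mult_diag:
  "A \<in> UT n \<Longrightarrow> B \<in> UT n \<Longrightarrow> i < n \<Longrightarrow> (A * B) $$ (i,i) = A $$ (i,i) * B $$ (i,i)"
  by (simp add: UT_mult_index del: index_mult_mat)

section \<open>Matrix units\<close>

lemma mat_unit_UT: "i \<le> j \<Longrightarrow> mat_unit n i j \<in> UT n"
  by (auto simp: UT_iff mat_unit_def)

lemma mat_unit_carrier [simp]: "mat_unit n i j \<in> carrier_mat n n"
  by (simp add: mat_unit_def)

lemma mat_unit_dim [simp]: "dim_row (mat_unit n i j) = n" "dim_col (mat_unit n i j) = n"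
  by (simp_all add: mat_unit_def)

lemma mat_unit_index:
  "k < n \<Longrightarrow> l < n \<Longrightarrow> mat_unit n i j $$ (k,l) = (if k = i \<and> l = j then 1 else 0)"
  by (simp add: mat_unit_def)

lemma mat_unit_mult_index:
  assumes "A \<in> carrier_mat n n" "k < n" "l < n" "j < n"
  shows "(mat_unit n i j * A) $$ (k,l) = (if k = i then A $$ (j,l) else 0)"
proof -
  have "(mat_unit n i j * A) $$ (k,l) = (\<Sum>m<n. if m = j then (if k = i then A $$ (j,l) else 0) else 0)"
    unfolding mult_index[OF mat_unit_carrier assms(1-3)]
    using assms by (intro sum.cong) (auto simp: mat_unit_index)
  then show ?thesis using assms by simp
qed

lemma mult_mat_unit_index:
  assumes "A \<in> carrier_mat n n" "k < n" "l < n" "i < n"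
  shows "(A * mat_unit n i j) $$ (k,l) = (if l = j then A $$ (k,i) else 0)"
proof -
  have "(A * mat_unit n i j) $$ (k,l) = (\<Sum>m<n. if m = i then (if l = j then A $$ (k,i) else 0) else 0)"
    unfolding mult_index[OF assms(1) mat_unit_carrier assms(2,3)]
    using assms by (intro sum.cong) (auto simp: mat_unit_index)
  then show ?thesis using assms by simp
qed

lemma mat_unit_mult:
  assumes "i < n" "j < n" "k < n" "l < n"
  shows "mat_unit n i j * mat_unit n k l = (if j = k then mat_unit n i l else 0\<^sub>m n n :: 'a::field mat)"
proof (rule eq_matI)
  fix a b
  assume "a < dim_row (if j = k then mat_unit n i l else 0\<^sub>m n n :: 'a mat)"
    and "b < dim_col (if j = k then mat_unit n i l else 0\<^sub>m n n :: 'a mat)"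
  then have "a < n" "b < n" by (auto simp: mat_unit_def split: if_splits)
  then show "(mat_unit n i j * mat_unit n k l) $$ (a,b) =
      (if j = k then mat_unit n i l else 0\<^sub>m n n) $$ (a,b)"
    using assms by (simp add: mat_unit_mult_index mat_unit_index del: index_mult_mat)
qed (simp_all add: mat_unit_def)

text \<open>The determinant provides an inverse among all matrices; the point is that it is
  triangular. Below the diagonal, going from the bottom row upwards, entry \<open>(i,j)\<close> of
  \<open>A * B\<close> reduces to \<open>A $$ (i,i) * B $$ (i,j)\<close>.\<close>

lemma UT_unit:
  assumes A: "A \<in> UT n" and d: "\<And>i. i < n \<Longrightarrow> A $$ (i,i) \<noteq> (0::'a::field)"
  obtains B where "B \<in> UT n" "A * B = 1\<^sub>m n" "B * A = 1\<^sub>m n"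
proof -
  have c: "A \<in> carrier_mat n n" using A by (rule UT_carrier)
  have "0 \<notin> set (diag_mat A)" using d c by (auto simp: diag_mat_def)
  then have "det A \<noteq> 0"
    using upper_triangular_imp_det_eq_0_iff[OF c] A by (simp add: UT_def)
  from det_non_zero_imp_unit[OF c this, of "()"] obtain B where
    B: "B \<in> carrier_mat n n" "A * B = 1\<^sub>m n" "B * A = 1\<^sub>m n"
    by (auto simp: Units_def ring_mat_def)
  have "B $$ (i,j) = 0" if "i < n" "j < i" for i j
    using that
  proof (induction "n - i" arbitrary: i rule: less_induct)
    case less
    have "(\<Sum>k<n. A $$ (i,k) * B $$ (k,j)) = (\<Sum>k\<in>{i}. A $$ (i,k) * B $$ (k,j))"
    proof (rule sum.mono_neutral_right)
      show "\<forall>k\<in>{..<n} - {i}. A $$ (i,k) * B $$ (k,j) = 0"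
      proof
        fix k assume k: "k \<in> {..<n} - {i}"
        show "A $$ (i,k) * B $$ (k,j) = 0"
        proof (cases "k < i")
          case True
          then show ?thesis using A less by (simp add: UT_lower)
        next
          case False
          then have "i < k" "n - k < n - i" using k less.prems by auto
          then show ?thesis using k less.prems less.hyps[of k] by simp
        qed
      qed
    qed (use less in auto)
    moreover have "(A * B) $$ (i,j) = 0" using less unfolding B(2) by simp
    ultimately show ?case
      using less d by (simp add: mult_index[OF c B(1)] del: index_mult_mat)
  qed
  then have "B \<in> UT n" using B(1) by (auto simp: UT_iff)
  with B that show thesis by blast
qed

lemma UT_linearD:
  assumes "UT_linear n f"
  shows "A \<in> UT n \<Longrightarrow> B \<in> UT n \<Longrightarrow> f (A + B) = f A + f B" "A \<in> UT n \<Longrightarrow> f (c \<cdot>\<^sub>m A) = c \<cdot>\<^sub>m f A"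
  using assms by (auto simp: UT_linear_def)

lemma UT_linear_zero:
  assumes "UT_linear n f" "f (0\<^sub>m n n) \<in> UT n"
  shows "f (0\<^sub>m n n) = 0\<^sub>m n n"
proof -
  have "f (0 \<cdot>\<^sub>m 0\<^sub>m n n) = 0 \<cdot>\<^sub>m f (0\<^sub>m n n)"
    using assms(1) UT_zero by (rule UT_linearD)
  moreover have "0 \<cdot>\<^sub>m 0\<^sub>m n n = (0\<^sub>m n n :: 'a mat)" by auto
  moreover have "0 \<cdot>\<^sub>m f (0\<^sub>m n n) = 0\<^sub>m n n" using UT_carrier[OF assms(2)] by auto
  ultimately show ?thesis by simp
qed

lemma UT_minus_conv:
  "A \<in> UT n \<Longrightarrow> B \<in> UT n \<Longrightarrow> A - B = A + (-1) \<cdot>\<^sub>m B"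
  by (rule eq_matI) auto

section \<open>Finite sums of matrices\<close>

lemma finsum_mat_empty: "finsum (module_mat TYPE('a::field) n n) a {} = 0\<^sub>m n n"
proof -
  interpret abelian_group "module_mat TYPE('a) n n" by (rule abelian_group_mat)
  show ?thesis by (simp add: module_mat_simps)
qed

lemma finsum_mat_insert:
  assumes "finite S" "s \<notin> S" "\<And>x. x \<in> insert s S \<Longrightarrow> a x \<in> carrier_mat n n"
  shows "finsum (module_mat TYPE('a::field) n n) a (insert s S) =
    a s + finsum (module_mat TYPE('a) n n) a S"
proof -
  interpret abelian_group "module_mat TYPE('a) n n" by (rule abelian_group_mat)
  show ?thesis using assms finsum_insert[of S s a] by (auto simp: module_mat_simps)
qed

lemma finsum_mat_index:
  assumes "finite S" "\<And>x. x \<in> S \<Longrightarrow> a x \<in> carrier_mat n n"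
  shows "finsum (module_mat TYPE('a::field) n n) a S \<in> carrier_mat n n \<and>
    (\<forall>i<n. \<forall>j<n. finsum (module_mat TYPE('a) n n) a S $$ (i,j) = (\<Sum>x\<in>S. a x $$ (i,j)))"
  using assms
proof (induction S)
  case empty
  then show ?case by (simp add: finsum_mat_empty)
next
  case (insert s S)
  then have IH: "finsum (module_mat TYPE('a) n n) a S \<in> carrier_mat n n"
    "\<forall>i<n. \<forall>j<n. finsum (module_mat TYPE('a) n n) a S $$ (i,j) = (\<Sum>x\<in>S. a x $$ (i,j))"
    by auto
  have *: "finsum (module_mat TYPE('a) n n) a (insert s S) = a s + finsum (module_mat TYPE('a) n n) a S"
    using insert by (intro finsum_mat_insert) auto
  show ?case unfolding * using IH insert by auto
qed

lemma finsum_mat_induct [consumes 2, case_names zero add mem]: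
  assumes "finite S" "P (0\<^sub>m n n)"
    "\<And>A B. A \<in> UT n \<Longrightarrow> B \<in> UT n \<Longrightarrow> P A \<Longrightarrow> P B \<Longrightarrow> P (A + B)"
    "\<And>x. x \<in> S \<Longrightarrow> a x \<in> UT n \<and> P (a x)"
  shows "finsum (module_mat TYPE('a::field) n n) a S \<in> UT n \<and> P (finsum (module_mat TYPE('a) n n) a S)"
  using assms(1,4)
proof (induction S)
  case empty
  then show ?case using assms(2) by (simp add: finsum_mat_empty UT_zero)
next
  case (insert s S)
  have *: "finsum (module_mat TYPE('a) n n) a (insert s S) = a s + finsum (module_mat TYPE('a) n n) a S"
    using insert by (intro finsum_mat_insert) (auto intro: UT_carrier)
  show ?case unfolding * using insert assms(3) by (simp add: UT_add)
qed

lemma finsum_UT: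
  assumes "finite S" "\<And>x. x \<in> S \<Longrightarrow> a x \<in> UT n"
  shows "finsum (module_mat TYPE('a::field) n n) a S \<in> UT n"
  using finsum_mat_induct[of S "\<lambda>_. True" n a] assms by blast

lemma finsum_mat_linear:
  assumes f: "UT_linear n f" "\<And>A. A \<in> UT n \<Longrightarrow> f A \<in> UT n"
    and S: "finite S" "\<And>x. x \<in> S \<Longrightarrow> a x \<in> UT n"
  shows "f (finsum (module_mat TYPE('a::field) n n) a S) =
    finsum (module_mat TYPE('a) n n) (\<lambda>x. f (a x)) S"
  using S
proof (induction S)
  case empty
  then show ?case using f by (simp add: finsum_mat_empty UT_linear_zero UT_zero)
next
  case (insert s S)
  have *: "finsum (module_mat TYPE('a) n n) a (insert s S) = a s + finsum (module_mat TYPE('a) n n) a S"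
    using insert by (intro finsum_mat_insert) (auto intro: UT_carrier)
  have **: "finsum (module_mat TYPE('a) n n) (\<lambda>x. f (a x)) (insert s S) =
      f (a s) + finsum (module_mat TYPE('a) n n) (\<lambda>x. f (a x)) S"
    using insert f(2) by (intro finsum_mat_insert) (auto intro: UT_carrier)
  have "finsum (module_mat TYPE('a) n n) a S \<in> UT n"
    using finsum_mat_induct[of S "\<lambda>_. True" n a] insert by auto
  then show ?case unfolding * ** using insert UT_linearD(1)[OF f(1)] by simp
qed

section \<open>Homogeneous components\<close>

locale graded_UT = comm_group G for G :: "('g, 'm) monoid_scheme" (structure) +
  fixes n :: nat and R :: "'g \<Rightarrow> 'a::field mat set"
  assumes fin: "finite (carrier G)" and grading: "UT_grading G n R"
begin

lemma homog_UT: "A \<in> R g \<Longrightarrow> g \<in> carrier G \<Longrightarrow> A \<in> UT n"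
  and homog_zero: "g \<in> carrier G \<Longrightarrow> 0\<^sub>m n n \<in> R g"
  and homog_add: "A \<in> R g \<Longrightarrow> B \<in> R g \<Longrightarrow> g \<in> carrier G \<Longrightarrow> A + B \<in> R g"
  and homog_smult: "A \<in> R g \<Longrightarrow> g \<in> carrier G \<Longrightarrow> c \<cdot>\<^sub>m A \<in> R g"
  and homog_mult:
    "A \<in> R g \<Longrightarrow> B \<in> R h \<Longrightarrow> g \<in> carrier G \<Longrightarrow> h \<in> carrier G \<Longrightarrow> A * B \<in> R (g \<otimes> h)"
  using grading unfolding UT_grading_def by blast+

lemma homog_minus: "A \<in> R g \<Longrightarrow> B \<in> R g \<Longrightarrow> g \<in> carrier G \<Longrightarrow> A - B \<in> R g"
  by (subst UT_minus_conv) (auto intro: homog_UT homog_add homog_smult)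

definition component :: "'a mat \<Rightarrow> 'g \<Rightarrow> 'a mat" where
  "component A = (THE a. a \<in> (\<Pi>\<^sub>E g\<in>carrier G. R g) \<and>
     finsum (module_mat TYPE('a) n n) a (carrier G) = A)"

lemma component_ex1:
  "A \<in> UT n \<Longrightarrow> \<exists>!a. a \<in> (\<Pi>\<^sub>E g\<in>carrier G. R g) \<and>
     finsum (module_mat TYPE('a) n n) a (carrier G) = A"
  using grading unfolding UT_grading_def by blast

lemma
  assumes "A \<in> UT n"
  shows component_homog: "g \<in> carrier G \<Longrightarrow> component A g \<in> R g"
    and component_finsum: "finsum (module_mat TYPE('a) n n) (component A) (carrier G) = A"
proof -
  have "component A \<in> (\<Pi>\<^sub>E g\<in>carrier G. R g) \<and>
     finsum (module_mat TYPE('a) n n) (component A) (carrier G) = A"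
    unfolding component_def using theI'[OF component_ex1[OF assms]] .
  then show "g \<in> carrier G \<Longrightarrow> component A g \<in> R g"
    "finsum (module_mat TYPE('a) n n) (component A) (carrier G) = A" by auto
qed

lemma component_UT: "A \<in> UT n \<Longrightarrow> g \<in> carrier G \<Longrightarrow> component A g \<in> UT n"
  using component_homog homog_UT by blast

lemma component_sum:
  assumes "A \<in> UT n" "i < n" "j < n"
  shows "A $$ (i,j) = (\<Sum>g\<in>carrier G. component A g $$ (i,j))"
proof -
  have "finsum (module_mat TYPE('a) n n) (component A) (carrier G) $$ (i,j) =
      (\<Sum>g\<in>carrier G. component A g $$ (i,j))"
    using finsum_mat_index[OF fin, of "component A" n] assms component_UT UT_carrier by blast
  then show ?thesis by (simp add: component_finsum assms)
qed

text \<open>Allows decompositions to be recognised entry by entry, with ordinary sums over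
  \<open>carrier G\<close> in place of \<open>finsum\<close>.\<close>

lemma component_unique:
  assumes A: "A \<in> UT n" and f: "\<And>g. g \<in> carrier G \<Longrightarrow> f g \<in> R g"
    and s: "\<And>i j. i \<le> j \<Longrightarrow> j < n \<Longrightarrow> A $$ (i,j) = (\<Sum>g\<in>carrier G. f g $$ (i,j))"
    and g: "g \<in> carrier G"
  shows "component A g = f g"
proof -
  let ?f = "restrict f (carrier G)"
  let ?S = "finsum (module_mat TYPE('a) n n) ?f (carrier G)"
  have f': "?f g \<in> UT n" if "g \<in> carrier G" for g using that homog_UT[OF f] by simp
  have "?f g \<in> carrier_mat n n" if "g \<in> carrier G" for g
    using f'[OF that] by (rule UT_carrier)
  note S = finsum_mat_index[OF fin, of ?f, OF this]
  have idx: "?S $$ (i,j) = (\<Sum>g\<in>carrier G. f g $$ (i,j))" if "i < n" "j < n" for i j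
    using S that by (simp cong: sum.cong)
  have "?S \<in> UT n"
    using finsum_mat_induct[OF fin, of "\<lambda>_. True" n ?f] f' by blast
  then have "?S = A" by (rule UT_eqI[OF _ A]) (simp add: idx s)
  then have "?f = component A"
    using component_ex1[OF A] component_homog[OF A] component_finsum[OF A] f
      theI'[OF component_ex1[OF A], folded component_def] by auto
  then show ?thesis using g by (metis restrict_apply')
qed

lemma component_of_homog:
  assumes "A \<in> R g" "g \<in> carrier G" "h \<in> carrier G"
  shows "component A h = (if h = g then A else 0\<^sub>m n n)"
proof (rule component_unique)
  show "A \<in> UT n" using assms homog_UT by blast
  fix i j assume ij: "i \<le> j" "j < n"
  have "(\<Sum>h\<in>carrier G. (if h = g then A else 0\<^sub>m n n) $$ (i,j)) =
      (\<Sum>h\<in>carrier G. if h = g then A $$ (i,j) else 0)"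
    using ij by (intro sum.cong) auto
  then show "A $$ (i,j) = (\<Sum>h\<in>carrier G. (if h = g then A else 0\<^sub>m n n) $$ (i,j))"
    using assms fin by simp
qed (use assms homog_zero in auto)

lemma homogI:
  assumes "A \<in> UT n" "g \<in> carrier G"
    "\<And>h. h \<in> carrier G \<Longrightarrow> h \<noteq> g \<Longrightarrow> component A h = 0\<^sub>m n n"
  shows "A \<in> R g"
proof -
  have "A = component A g"
  proof (rule UT_eqI)
    fix i j assume ij: "i \<le> j" "j < n"
    have "A $$ (i,j) = (\<Sum>h\<in>carrier G. if h = g then component A g $$ (i,j) else 0)"
      unfolding component_sum[OF assms(1) le_less_trans[OF ij] ij(2)]
      using ij assms(3) by (intro sum.cong) auto
    then show "A $$ (i,j) = component A g $$ (i,j)" using assms fin by simp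
  qed (use assms component_UT in auto)
  then show ?thesis using component_homog[OF assms(1,2)] by simp
qed

text \<open>Multiplication by a homogeneous \<open>A\<close> only shifts the decomposition of
  \<open>B\<close>: the products of \<open>A\<close> with the components of \<open>B\<close> are
  homogeneous of distinct degrees.\<close>

lemma component_mult_left:
  assumes A: "A \<in> R g" and g: "g \<in> carrier G" and B: "B \<in> UT n" and h: "h \<in> carrier G"
  shows "component (A * B) (g \<otimes> h) = A * component B h"
proof -
  have AU: "A \<in> UT n" using A g homog_UT by blast
  \<comment> \<open>The degree is left unsimplified so that the right side is a value, at
    \<open>k = g \<otimes> h\<close>, of the family to which uniqueness applies.\<close>
  have "component (A * B) (g \<otimes> h) = A * component B (inv g \<otimes> (g \<otimes> h))"
  proof (rule component_unique)
    show "A * component B (inv g \<otimes> k) \<in> R k" if "k \<in> carrier G" for k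
      using homog_mult[OF A component_homog[OF B, of "inv g \<otimes> k"] g] that g
      by (simp add: m_assoc[symmetric])
    fix i j assume ij: "i \<le> j" "j < n"
    have bij: "bij_betw (\<lambda>k. inv g \<otimes> k) (carrier G) (carrier G)"
      by (rule bij_betw_byWitness[where f' = "\<lambda>k. g \<otimes> k"]) (auto simp: g m_assoc[symmetric])
    have "(A * B) $$ (i,j) = (\<Sum>l=i..j. \<Sum>k\<in>carrier G. A $$ (i,l) * component B k $$ (l,j))"
      unfolding UT_mult_index[OF AU B ij]
      using ij by (simp add: component_sum[OF B] sum_distrib_left)
    also have "\<dots> = (\<Sum>k\<in>carrier G. \<Sum>l=i..j. A $$ (i,l) * component B k $$ (l,j))"
      by (rule sum.swap)
    also have "\<dots> = (\<Sum>k\<in>carrier G. (A * component B k) $$ (i,j))"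
      by (intro sum.cong refl, subst UT_mult_index[OF AU]) (use ij component_UT[OF B] in auto)
    also have "\<dots> = (\<Sum>k\<in>carrier G. (A * component B (inv g \<otimes> k)) $$ (i,j))"
      by (rule sum.reindex_bij_betw[OF bij, symmetric])
    finally show "(A * B) $$ (i,j) = \<dots>" .
  qed (use g h UT_mult AU B in auto)
  then show ?thesis using g h by (simp add: m_assoc[symmetric])
qed

lemma component_mult_right:
  assumes A: "A \<in> R g" and g: "g \<in> carrier G" and B: "B \<in> UT n" and h: "h \<in> carrier G"
  shows "component (B * A) (h \<otimes> g) = component B h * A"
proof -
  have AU: "A \<in> UT n" using A g homog_UT by blast
  have "component (B * A) (h \<otimes> g) = component B ((h \<otimes> g) \<otimes> inv g) * A"
  proof (rule component_unique)
    show "component B (k \<otimes> inv g) * A \<in> R k" if "k \<in> carrier G" for k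
      using homog_mult[OF component_homog[OF B, of "k \<otimes> inv g"] A _ g] that g
      by (simp add: m_assoc)
    fix i j assume ij: "i \<le> j" "j < n"
    have bij: "bij_betw (\<lambda>k. k \<otimes> inv g) (carrier G) (carrier G)"
      by (rule bij_betw_byWitness[where f' = "\<lambda>k. k \<otimes> g"]) (auto simp: g m_assoc)
    have "(B * A) $$ (i,j) = (\<Sum>l=i..j. \<Sum>k\<in>carrier G. component B k $$ (i,l) * A $$ (l,j))"
      unfolding UT_mult_index[OF B AU ij]
      using ij by (simp add: component_sum[OF B] sum_distrib_right)
    also have "\<dots> = (\<Sum>k\<in>carrier G. \<Sum>l=i..j. component B k $$ (i,l) * A $$ (l,j))"
      by (rule sum.swap)
    also have "\<dots> = (\<Sum>k\<in>carrier G. (component B k * A) $$ (i,j))"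
      by (intro sum.cong refl, subst UT_mult_index[OF _ AU]) (use ij component_UT[OF B] in auto)
    also have "\<dots> = (\<Sum>k\<in>carrier G. (component B (k \<otimes> inv g) * A) $$ (i,j))"
      by (rule sum.reindex_bij_betw[OF bij, symmetric])
    finally show "(B * A) $$ (i,j) = \<dots>" .
  qed (use g h UT_mult AU B in auto)
  then show ?thesis using g h by (simp add: m_assoc)
qed

lemma homog_induct [consumes 1, case_names homog add]:
  assumes A: "A \<in> UT n"
    and homog: "\<And>g B. g \<in> carrier G \<Longrightarrow> B \<in> R g \<Longrightarrow> P B"
    and add: "\<And>B C. B \<in> UT n \<Longrightarrow> C \<in> UT n \<Longrightarrow> P B \<Longrightarrow> P C \<Longrightarrow> P (B + C)"
  shows "P A"
proof -
  have "P (finsum (module_mat TYPE('a) n n) (component A) (carrier G))"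
    using finsum_mat_induct[OF fin, of P n "component A"] homog[OF _ homog_zero[OF one_closed]]
      homog component_homog[OF A] component_UT[OF A] add by blast
  then show ?thesis by (simp add: component_finsum[OF A])
qed

text \<open>For \<open>A\<close> of degree \<open>g\<close>, multiplying by the degree
  \<open>h\<close> component of the identity gives the component of \<open>A\<close> in degree
  \<open>g \<otimes> h \<noteq> g\<close>, which is zero. By linearity every \<open>A\<close> kills
  that component, in particular the identity does.\<close>

lemma one_homog: "1\<^sub>m n \<in> R \<one>"
proof (rule homogI[OF UT_one one_closed])
  fix h assume h: "h \<in> carrier G" "h \<noteq> \<one>"
  let ?c = "component (1\<^sub>m n) h"
  have "A * ?c = 0\<^sub>m n n" if "A \<in> UT n" for A
    using that
  proof (induction rule: homog_induct)
    case (homog g B)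
    have B: "B \<in> UT n" using homog homog_UT by blast
    have "g \<otimes> h \<noteq> g" using homog h by simp
    then have "component B (g \<otimes> h) = 0\<^sub>m n n"
      using component_of_homog[OF homog(2,1)] homog(1) h by simp
    then show ?case
      using component_mult_left[OF homog(2,1) UT_one h(1)] B by (simp add: UT_one_mult)
  next
    case (add B C)
    then show ?case
      using component_UT[OF UT_one h(1)] by (simp add: add_mult_distrib_mat[OF UT_carrier UT_carrier UT_carrier])
  qed
  from this[OF UT_one] show "?c = 0\<^sub>m n n"
    using component_UT[OF UT_one h(1)] by (simp add: UT_one_mult)
qed

text \<open>Left multiplication by \<open>A\<close> sends \<open>component B h\<close> to the degree
  \<open>h\<close> component of the identity, which is zero for \<open>h \<noteq> \<one>\<close>,
  and \<open>A\<close> can be cancelled.\<close>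

lemma inverse_homog:
  assumes "A \<in> R \<one>" "B \<in> UT n" "A * B = 1\<^sub>m n" "B * A = 1\<^sub>m n"
  shows "B \<in> R \<one>"
proof (rule homogI[OF assms(2) one_closed])
  fix h assume h: "h \<in> carrier G" "h \<noteq> \<one>"
  have A: "A \<in> UT n" using assms homog_UT by blast
  have "A * component B h = 0\<^sub>m n n"
    using component_mult_left[OF assms(1) one_closed assms(2) h(1)] h assms(3)
      component_of_homog[OF one_homog one_closed h(1)] by simp
  then show "component B h = 0\<^sub>m n n"
    using UT_mult_cancel[OF assms(2) A component_UT[OF assms(2) h(1)] assms(4)]
    by (simp add: UT_mult_zero assms)
qed

end

section \<open>Homogeneous flags\<close>

text \<open>The commutators span the strictly upper triangular matrices, so the two families below can be
  described by commutators alone, which makes them compatible with gradings and involutions.\<close>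

definition last_cols :: "nat \<Rightarrow> nat \<Rightarrow> 'a::field mat set" where
  "last_cols n m = {A \<in> UT n. \<forall>i<n. \<forall>j<n. j < n - m \<longrightarrow> A $$ (i,j) = 0}"

definition first_rows :: "nat \<Rightarrow> nat \<Rightarrow> 'a::field mat set" where
  "first_rows n m = {A \<in> UT n. \<forall>i<n. \<forall>j<n. m \<le> i \<longrightarrow> A $$ (i,j) = 0}"

lemma last_cols_add: "A \<in> last_cols n m \<Longrightarrow> B \<in> last_cols n m \<Longrightarrow> A + B \<in> last_cols n m"
  and first_rows_add: "A \<in> first_rows n m \<Longrightarrow> B \<in> first_rows n m \<Longrightarrow> A + B \<in> first_rows n m"
  by (auto simp: last_cols_def first_rows_def UT_iff)

lemma last_cols_0: "last_cols n 0 = {0\<^sub>m n n}"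
  by (auto simp: last_cols_def UT_iff)

lemma first_rows_0: "first_rows n 0 = {0\<^sub>m n n}"
  by (auto simp: first_rows_def UT_iff)

lemma commutator_strict:
  assumes "A \<in> UT n" "B \<in> UT n" "j \<le> i" "i < n"
  shows "(A * B - B * A) $$ (i,j) = (0::'a::field)"
proof (cases "j = i")
  case True
  then show ?thesis using assms UT_mult[OF assms(1,2)] UT_mult[OF assms(2,1)]
    by (simp add: UT_dim[OF assms(1)] UT_dim[OF assms(2)] UT_mult_diag del: index_mult_mat(1))
next
  case False
  then show ?thesis
    using assms UT_lower[OF UT_minus[OF UT_mult[OF assms(1,2)] UT_mult[OF assms(2,1)]]] by simp
qed

lemma commutator_mat_unit:
  assumes "i < j" "j < n"
  shows "mat_unit n i i * mat_unit n i j - mat_unit n i j * mat_unit n i i = (mat_unit n i j :: 'a::field mat)"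
  using assms by (simp add: mat_unit_mult) (auto simp: mat_unit_def)

text \<open>Commutators are strictly upper triangular, so multiplying by them on the right moves the
  column support to the right. Unrolled, the recursion makes \<open>last_cols n m\<close> the left
  annihilator of all products of \<open>m\<close> commutators.\<close>

lemma last_cols_Suc:
  assumes "m < n"
  shows "last_cols n (Suc m) =
    {A \<in> UT n. \<forall>B\<in>UT n. \<forall>C\<in>UT n. A * (B * C - C * B) \<in> (last_cols n m :: 'a::field mat set)}"
proof (intro equalityI subsetI CollectI conjI ballI)
  fix A :: "'a mat" assume A: "A \<in> last_cols n (Suc m)"
  then show AU: "A \<in> UT n" by (simp add: last_cols_def)
  fix B C :: "'a mat" assume BC: "B \<in> UT n" "C \<in> UT n"
  let ?D = "B * C - C * B"
  have D: "?D \<in> UT n" using BC by (simp add: UT_closed)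
  have "(A * ?D) $$ (i,j) = 0" if "i < n" "j < n" "j < n - m" for i j
  proof -
    have "A $$ (i,k) * ?D $$ (k,j) = 0" if "k < n" for k
    proof (cases "j \<le> k")
      case True
      then show ?thesis using commutator_strict[OF BC True that] by simp
    next
      case False
      then show ?thesis using A \<open>j < n - m\<close> \<open>i < n\<close> that by (auto simp: last_cols_def)
    qed
    then show ?thesis using that sum.neutral[of "{..<n}" "\<lambda>k. A $$ (i,k) * ?D $$ (k,j)"]
      by (simp add: mult_index[OF UT_carrier[OF AU] UT_carrier[OF D]] del: index_mult_mat index_minus_mat)
  qed
  then show "A * ?D \<in> last_cols n m"
    unfolding last_cols_def using UT_mult[OF AU D] by blast
next
  fix A :: "'a mat"
  assume "A \<in> {A \<in> UT n. \<forall>B\<in>UT n. \<forall>C\<in>UT n. A * (B * C - C * B) \<in> last_cols n m}"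
  then have A: "A \<in> UT n" and H: "\<And>B C. B \<in> UT n \<Longrightarrow> C \<in> UT n \<Longrightarrow> A * (B * C - C * B) \<in> last_cols n m"
    by auto
  have "A $$ (i,j) = 0" if ij: "i < n" "j < n" "j < n - Suc m" for i j
  proof -
    \<comment> \<open>The commutator of \<open>e_jj\<close> and \<open>e_j(j+1)\<close> is
      \<open>e_j(j+1)\<close>, which copies column \<open>j\<close> into column
      \<open>j + 1\<close>.\<close>
    have "A * mat_unit n j (Suc j) \<in> last_cols n m"
      using H[OF mat_unit_UT[of j j] mat_unit_UT[of j "Suc j"]] ij by (simp add: commutator_mat_unit)
    then have "(A * mat_unit n j (Suc j)) $$ (i, Suc j) = 0"
      using ij unfolding last_cols_def by simp
    then show ?thesis
      using mult_mat_unit_index[OF UT_carrier[OF A], of i "Suc j" j "Suc j"] ij by simp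
  qed
  then show "A \<in> last_cols n (Suc m)" using A unfolding last_cols_def by blast
qed

text \<open>The mirror image, with right annihilators: \<open>e_(i-1)i\<close> on the left copies
  row \<open>i\<close> into row \<open>i - 1\<close>.\<close>

lemma first_rows_Suc:
  assumes "m < n"
  shows "first_rows n (Suc m) =
    {A \<in> UT n. \<forall>B\<in>UT n. \<forall>C\<in>UT n. (B * C - C * B) * A \<in> (first_rows n m :: 'a::field mat set)}"
proof (intro equalityI subsetI CollectI conjI ballI)
  fix A :: "'a mat" assume A: "A \<in> first_rows n (Suc m)"
  then show AU: "A \<in> UT n" by (simp add: first_rows_def)
  fix B C :: "'a mat" assume BC: "B \<in> UT n" "C \<in> UT n"
  let ?D = "B * C - C * B"
  have D: "?D \<in> UT n" using BC by (simp add: UT_closed)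
  have "(?D * A) $$ (i,j) = 0" if "i < n" "j < n" "m \<le> i" for i j
  proof -
    have "?D $$ (i,k) * A $$ (k,j) = 0" if "k < n" for k
    proof (cases "k \<le> i")
      case True
      then show ?thesis using commutator_strict[OF BC True \<open>i < n\<close>] by simp
    next
      case False
      then show ?thesis using A \<open>m \<le> i\<close> \<open>j < n\<close> that by (auto simp: first_rows_def)
    qed
    then show ?thesis using that sum.neutral[of "{..<n}" "\<lambda>k. ?D $$ (i,k) * A $$ (k,j)"]
      by (simp add: mult_index[OF UT_carrier[OF D] UT_carrier[OF AU]] del: index_mult_mat index_minus_mat)
  qed
  then show "?D * A \<in> first_rows n m"
    unfolding first_rows_def using UT_mult[OF D AU] by blast
next
  fix A :: "'a mat"
  assume "A \<in> {A \<in> UT n. \<forall>B\<in>UT n. \<forall>C\<in>UT n. (B * C - C * B) * A \<in> first_rows n m}"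
  then have A: "A \<in> UT n" and H: "\<And>B C. B \<in> UT n \<Longrightarrow> C \<in> UT n \<Longrightarrow> (B * C - C * B) * A \<in> first_rows n m"
    by auto
  have "A $$ (i,j) = 0" if ij: "i < n" "j < n" "Suc m \<le> i" for i j
  proof -
    have "mat_unit n (i - 1) i * A \<in> first_rows n m"
      using H[OF mat_unit_UT[of "i-1" "i-1"] mat_unit_UT[of "i-1" i]] ij by (simp add: commutator_mat_unit)
    then have "(mat_unit n (i - 1) i * A) $$ (i - 1, j) = 0"
      using ij unfolding first_rows_def by simp
    then show ?thesis
      using mat_unit_mult_index[OF UT_carrier[OF A], of "i-1" j i "i-1"] ij by simp
  qed
  then show "A \<in> first_rows n (Suc m)" using A unfolding first_rows_def by blast
qed

section \<open>Graded flags and a homogeneous basis of the row vectors\<close>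

context graded_UT
begin

lemma component_zero: "g \<in> carrier G \<Longrightarrow> component (0\<^sub>m n n) g = 0\<^sub>m n n"
  using component_of_homog[OF homog_zero[OF one_closed] one_closed] by simp

text \<open>Commutativity of \<open>G\<close> enters here: for homogeneous \<open>B\<close> and
  \<open>C\<close> the products \<open>B * C\<close> and \<open>C * B\<close> have the same degree,
  so by bilinearity every commutator is a sum of homogeneous ones.\<close>

lemma commutator_induct [consumes 2, case_names homog add]:
  assumes B: "B \<in> UT n" and C: "C \<in> UT n"
    and homog: "\<And>g B C. \<lbrakk>g \<in> carrier G; B \<in> UT n; C \<in> UT n; B * C - C * B \<in> R g\<rbrakk> \<Longrightarrow> P (B * C - C * B)"
    and add: "\<And>D E. \<lbrakk>D \<in> UT n; E \<in> UT n; P D; P E\<rbrakk> \<Longrightarrow> P (D + E)"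
  shows "P (B * C - C * B)"
  using B
proof (induction rule: homog_induct)
  case (homog g B)
  have BU: "B \<in> UT n" using homog homog_UT by blast
  show ?case
    using C
  proof (induction rule: homog_induct)
    case (homog h C)
    have CU: "C \<in> UT n" using homog homog_UT by blast
    have "B * C \<in> R (g \<otimes> h)" "C * B \<in> R (g \<otimes> h)"
      using homog_mult[of B g C h] homog_mult[of C h B g] m_comm[of g h] homog \<open>B \<in> R g\<close> \<open>g \<in> carrier G\<close>
      by simp_all
    then have "B * C - C * B \<in> R (g \<otimes> h)"
      using homog_minus homog \<open>g \<in> carrier G\<close> by simp
    then show ?case
      using assms(3)[of "g \<otimes> h" B C] BU CU homog \<open>g \<in> carrier G\<close> by simp
  next
    case (add C D)
    have "B * (C + D) - (C + D) * B = (B * C - C * B) + (B * D - D * B)"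
      unfolding mult_add_distrib_mat[OF UT_carrier UT_carrier UT_carrier, OF BU add(1,2)]
        add_mult_distrib_mat[OF UT_carrier UT_carrier UT_carrier, OF add(1,2) BU]
      by (rule eq_matI) (use BU add(1,2) in \<open>auto simp: UT_iff simp del: index_mult_mat(1)\<close>)
    then show ?case
      using assms(4)[of "B * C - C * B" "B * D - D * B"] add BU by (simp add: UT_closed)
  qed
next
  case (add B D)
  have "(B + D) * C - C * (B + D) = (B * C - C * B) + (D * C - C * D)"
    unfolding mult_add_distrib_mat[OF UT_carrier UT_carrier UT_carrier, OF C add(1,2)]
      add_mult_distrib_mat[OF UT_carrier UT_carrier UT_carrier, OF add(1,2) C]
    by (rule eq_matI) (use C add(1,2) in \<open>auto simp: UT_iff simp del: index_mult_mat(1)\<close>)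
  then show ?case
    using assms(4)[of "B * C - C * B" "D * C - C * D"] add C by (simp add: UT_closed)
qed

text \<open>For a commutator \<open>D\<close> of degree \<open>h\<close>,
  \<open>component A g * D\<close> is the component of \<open>A * D\<close> in degree
  \<open>g \<otimes> h\<close>, which the induction hypothesis controls. Sums of such
  \<open>D\<close> exhaust the commutators, so the recursive description passes to
  components.\<close>

lemma last_cols_graded:
  assumes "m \<le> n" "A \<in> last_cols n m" "g \<in> carrier G"
  shows "component A g \<in> last_cols n m"
  using assms
proof (induction m arbitrary: A g)
  case 0
  then show ?case by (simp add: last_cols_0 component_zero)
next
  case (Suc m)
  from Suc.prems have A: "A \<in> UT n"
    and H: "\<And>B C. B \<in> UT n \<Longrightarrow> C \<in> UT n \<Longrightarrow> A * (B * C - C * B) \<in> last_cols n m"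
    by (auto simp: last_cols_Suc)
  have c: "component A g \<in> UT n" using component_UT[OF A] Suc.prems by simp
  have "component A g * (B * C - C * B) \<in> last_cols n m" if "B \<in> UT n" "C \<in> UT n" for B C
    using that
  proof (induction rule: commutator_induct)
    case (homog h B C)
    have "component (A * (B * C - C * B)) (g \<otimes> h) = component A g * (B * C - C * B)"
      using component_mult_right homog A Suc.prems by simp
    then show ?case using Suc.IH[OF _ H[OF homog(2,3)], of "g \<otimes> h"] Suc.prems homog by simp
  next
    case (add D E)
    then show ?case
      using mult_add_distrib_mat[OF UT_carrier[OF c] UT_carrier UT_carrier] last_cols_add by metis
  qed
  then show ?case using c Suc.prems by (simp add: last_cols_Suc)
qed

lemma first_rows_graded:
  assumes "m \<le> n" "A \<in> first_rows n m" "g \<in> carrier G"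
  shows "component A g \<in> first_rows n m"
  using assms
proof (induction m arbitrary: A g)
  case 0
  then show ?case by (simp add: first_rows_0 component_zero)
next
  case (Suc m)
  from Suc.prems have A: "A \<in> UT n"
    and H: "\<And>B C. B \<in> UT n \<Longrightarrow> C \<in> UT n \<Longrightarrow> (B * C - C * B) * A \<in> first_rows n m"
    by (auto simp: first_rows_Suc)
  have c: "component A g \<in> UT n" using component_UT[OF A] Suc.prems by simp
  have "(B * C - C * B) * component A g \<in> first_rows n m" if "B \<in> UT n" "C \<in> UT n" for B C
    using that
  proof (induction rule: commutator_induct)
    case (homog h B C)
    have "component ((B * C - C * B) * A) (h \<otimes> g) = (B * C - C * B) * component A g"
      using component_mult_left homog A Suc.prems by simp
    then show ?case using Suc.IH[OF _ H[OF homog(2,3)], of "h \<otimes> g"] Suc.prems homog by simp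
  next
    case (add D E)
    then show ?case
      using add_mult_distrib_mat[OF UT_carrier UT_carrier UT_carrier[OF c]] first_rows_add by metis
  qed
  then show ?case using c Suc.prems by (simp add: first_rows_Suc)
qed

text \<open>\<open>first_rows n 1\<close> is the module of row vectors, and
  \<open>last_cols n (n - k)\<close> requires the first \<open>k\<close> entries to vanish. Both are
  graded, so the components of \<open>e_0k\<close> stay inside, and one of them keeps a nonzero
  entry at \<open>(0,k)\<close>.\<close>

lemma homog_row_vector:
  assumes k: "k < n"
  shows "\<exists>v d. d \<in> carrier G \<and> v \<in> R d \<and> v \<in> first_rows n 1 \<and> (\<forall>j<k. v $$ (0,j) = 0) \<and> v $$ (0,k) \<noteq> 0"
proof -
  let ?E = "mat_unit n 0 k :: 'a mat"
  have E: "?E \<in> UT n" "?E \<in> first_rows n 1" "?E \<in> last_cols n (n - k)"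
    using k by (auto simp: mat_unit_UT first_rows_def last_cols_def mat_unit_index)
  have "(\<Sum>g\<in>carrier G. component ?E g $$ (0,k)) \<noteq> 0"
    using component_sum[OF E(1), of 0 k] k by (simp add: mat_unit_index)
  then obtain d where d: "d \<in> carrier G" "component ?E d $$ (0,k) \<noteq> 0"
    by (rule sum.not_neutral_contains_not_neutral)
  moreover have "component ?E d \<in> R d" using component_homog[OF E(1) d(1)] .
  moreover have "component ?E d \<in> first_rows n 1"
    using first_rows_graded[OF _ E(2) d(1)] k by simp
  moreover have "component ?E d \<in> last_cols n (n - k)"
    using last_cols_graded[OF _ E(3) d(1)] by simp
  then have "\<forall>j<k. component ?E d $$ (0,j) = 0"
    using k by (auto simp: last_cols_def)
  ultimately show ?thesis by blast
qed

text \<open>The rows of \<open>P\<close> are the homogeneous row vectors \<open>v k\<close> of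
  degree \<open>d k\<close>. Right multiplication by \<open>Q * (e_ij * P)\<close> sends
  \<open>v i\<close> to \<open>v j\<close> and kills the other \<open>v k\<close>, which forces its
  degree.\<close>

lemma conj_elementary:
  obtains P Q d where "P \<in> UT n" "Q \<in> UT n" "P * Q = 1\<^sub>m n" "Q * P = 1\<^sub>m n"
    "\<And>i. i < n \<Longrightarrow> d i \<in> carrier G"
    "\<And>i j. i \<le> j \<Longrightarrow> j < n \<Longrightarrow> Q * (mat_unit n i j * P) \<in> R (inv (d i) \<otimes> d j)"
proof -
  have "\<forall>k\<in>{..<n}. \<exists>x. snd x \<in> carrier G \<and> fst x \<in> R (snd x) \<and> fst x \<in> first_rows n 1 \<and>
      (\<forall>j<k. fst x $$ (0,j) = 0) \<and> fst x $$ (0,k) \<noteq> 0"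
    using homog_row_vector by auto
  then obtain x where x: "\<forall>k\<in>{..<n}. snd (x k) \<in> carrier G \<and> fst (x k) \<in> R (snd (x k)) \<and>
      fst (x k) \<in> first_rows n 1 \<and> (\<forall>j<k. fst (x k) $$ (0,j) = 0) \<and> fst (x k) $$ (0,k) \<noteq> 0"
    by (rule bchoice[THEN exE])
  define v d where "v = fst \<circ> x" and "d = snd \<circ> x"
  have d: "d k \<in> carrier G" and v: "v k \<in> R (d k)" and fr: "v k \<in> first_rows n 1"
    and v0: "\<And>j. j < k \<Longrightarrow> v k $$ (0,j) = 0" and vk: "v k $$ (0,k) \<noteq> 0" if "k < n" for k
    using x that by (auto simp: v_def d_def)
  have vU: "v k \<in> UT n" if "k < n" for k using fr[OF that] by (simp add: first_rows_def)
  define P where "P = mat n n (\<lambda>(k,l). v k $$ (0,l))"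
  have Pi: "P $$ (k,l) = v k $$ (0,l)" if "k < n" "l < n" for k l using that by (simp add: P_def)
  have P: "P \<in> UT n" by (auto simp: UT_iff P_def v0)
  obtain Q where Q: "Q \<in> UT n" "P * Q = 1\<^sub>m n" "Q * P = 1\<^sub>m n"
    using UT_unit[OF P] vk by (auto simp: Pi)
  \<comment> \<open>Only the first row of \<open>v k * A\<close> is nonzero and it is row
    \<open>k\<close> of \<open>P * A\<close>, so statements about \<open>P * A\<close> can be tested
    on the homogeneous \<open>v k\<close>.\<close>
  have row: "(v k * A) $$ (i,l) = (if i = 0 then (P * A) $$ (k,l) else 0)"
    if "A \<in> UT n" "k < n" "i < n" "l < n" for A i k l
  proof -
    have "v k $$ (i,m) = (if i = 0 then P $$ (k,m) else 0)" if "m < n" for m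
      using fr[OF \<open>k < n\<close>] that \<open>k < n\<close> \<open>i < n\<close> by (auto simp: first_rows_def Pi)
    then show ?thesis
      using that by (simp add: mult_index[OF UT_carrier[OF vU] UT_carrier]
        mult_index[OF UT_carrier[OF P] UT_carrier] del: index_mult_mat)
  qed
  have "Q * (mat_unit n i j * P) \<in> R (inv (d i) \<otimes> d j)" if ij: "i \<le> j" "j < n" for i j
  proof (rule homogI)
    let ?EP = "mat_unit n i j * P"
    let ?A = "Q * ?EP"
    have EP: "?EP \<in> UT n" using mat_unit_UT[OF ij(1)] P by (rule UT_mult)
    show A: "?A \<in> UT n" using Q(1) EP by (rule UT_mult)
    have i: "i < n" using ij by simp
    have PA: "P * ?A = ?EP" using UT_mult_cancel P Q EP by blast
    show "inv (d i) \<otimes> d j \<in> carrier G" using d i ij by simp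
    have vA: "v k * ?A = (if k = i then v j else 0\<^sub>m n n)" if k: "k < n" for k
    proof (rule UT_eqI)
      fix a l assume "a \<le> l" "l < n"
      then show "(v k * ?A) $$ (a,l) = (if k = i then v j else 0\<^sub>m n n) $$ (a,l)"
        using fr[OF ij(2)] row[OF A k, of a l]
          mat_unit_mult_index[OF UT_carrier[OF P] k, of l j i] ij(2)
        by (auto simp: PA Pi first_rows_def simp del: index_mult_mat)
    qed (use UT_mult[OF vU[OF k] A] vU[OF ij(2)] UT_zero in auto)
    fix h assume h: "h \<in> carrier G" "h \<noteq> inv (d i) \<otimes> d j"
    have c: "component ?A h \<in> UT n" using component_UT[OF A h(1)] .
    \<comment> \<open>A component of another degree would send \<open>v i\<close> outside the degree
      of \<open>v j\<close>. Thus all \<open>v k\<close> kill it, hence so does the invertible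
      \<open>P\<close>.\<close>
    have "v k * component ?A h = 0\<^sub>m n n" if k: "k < n" for k
    proof (cases "k = i")
      case True
      have "d i \<otimes> h \<noteq> d j"
        using h d[OF i] d[OF ij(2)] inv_solve_left by metis
      then have "component (v j) (d i \<otimes> h) = 0\<^sub>m n n"
        using component_of_homog[OF v d, OF ij(2) ij(2)] d[OF i] h by simp
      then show ?thesis
        using component_mult_left[OF v[OF i] d[OF i] A h(1)] vA[OF i] True by simp
    next
      case False
      then show ?thesis
        using component_mult_left[OF v[OF k] d[OF k] A h(1)] vA[OF k] component_zero d[OF k] h by simp
    qed
    then have "P * component ?A h = 0\<^sub>m n n"
      using row[OF c, of _ 0] UT_mult[OF P c]
      by (intro UT_eqI[OF _ UT_zero]) (auto simp del: index_mult_mat)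
    then show "component ?A h = 0\<^sub>m n n"
      using UT_mult_cancel[OF Q(1) P c Q(3)] Q(1) by (simp add: UT_mult_zero)
  qed
  with that P Q d show thesis by blast
qed

end

section \<open>Transport along automorphisms\<close>

text \<open>The inverse is carried along explicitly so that an involution can be transported as
  \<open>\<phi> (star (\<psi> A))\<close>.\<close>

definition UT_auto :: "nat \<Rightarrow> ('a::field mat \<Rightarrow> 'a mat) \<Rightarrow> ('a mat \<Rightarrow> 'a mat) \<Rightarrow> bool" where
  "UT_auto n \<phi> \<psi> \<longleftrightarrow>
     (\<forall>A\<in>UT n. \<phi> A \<in> UT n \<and> \<psi> A \<in> UT n \<and> \<phi> (\<psi> A) = A \<and> \<psi> (\<phi> A) = A) \<and>
     UT_linear n \<phi> \<and> (\<forall>A\<in>UT n. \<forall>B\<in>UT n. \<phi> (A * B) = \<phi> A * \<phi> B)"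

lemma
  assumes "UT_auto n \<phi> \<psi>"
  shows UT_auto_UT: "A \<in> UT n \<Longrightarrow> \<phi> A \<in> UT n" "A \<in> UT n \<Longrightarrow> \<psi> A \<in> UT n"
    and UT_auto_inverse: "A \<in> UT n \<Longrightarrow> \<phi> (\<psi> A) = A" "A \<in> UT n \<Longrightarrow> \<psi> (\<phi> A) = A"
    and UT_auto_linear: "UT_linear n \<phi>"
    and UT_auto_mult: "A \<in> UT n \<Longrightarrow> B \<in> UT n \<Longrightarrow> \<phi> (A * B) = \<phi> A * \<phi> B"
  using assms unfolding UT_auto_def by auto

lemma UT_auto_sym:
  assumes "UT_auto n \<phi> \<psi>" shows "UT_auto n \<psi> \<phi>"
proof -
  note [simp] = UT_auto_UT[OF assms] UT_auto_inverse[OF assms]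
    UT_linearD[OF UT_auto_linear[OF assms]] UT_auto_mult[OF assms] UT_closed
  have "\<psi> (A + B) = \<psi> A + \<psi> B" "\<psi> (A * B) = \<psi> A * \<psi> B" if "A \<in> UT n" "B \<in> UT n" for A B
    using that UT_auto_inverse(2)[OF assms, of "\<psi> A + \<psi> B"]
      UT_auto_inverse(2)[OF assms, of "\<psi> A * \<psi> B"] by simp_all
  moreover have "\<psi> (c \<cdot>\<^sub>m A) = c \<cdot>\<^sub>m \<psi> A" if "A \<in> UT n" for A c
    using that UT_auto_inverse(2)[OF assms, of "c \<cdot>\<^sub>m \<psi> A"] by simp
  ultimately show ?thesis unfolding UT_auto_def UT_linear_def by simp
qed

lemma UT_auto_conj:
  assumes P: "P \<in> UT n" and Q: "Q \<in> UT n" and PQ: "P * Q = 1\<^sub>m n" and QP: "Q * P = 1\<^sub>m n"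
  shows "UT_auto n (\<lambda>A. P * (A * Q)) (\<lambda>A. Q * (A * P))"
proof -
  note [simp] = UT_mult_assoc[where n = n] UT_mult[where n = n] P Q PQ QP UT_one_mult[where n = n]
    UT_mult_cancel[OF P Q _ PQ] UT_mult_cancel[OF Q P _ QP]
  have "P * ((A + B) * Q) = P * (A * Q) + P * (B * Q)" if "A \<in> UT n" "B \<in> UT n" for A B
    using that add_mult_distrib_mat[OF UT_carrier UT_carrier UT_carrier, OF that Q]
      mult_add_distrib_mat[OF UT_carrier UT_carrier UT_carrier, OF P UT_mult UT_mult, OF that(1) Q that(2) Q]
    by simp
  moreover have "P * ((c \<cdot>\<^sub>m A) * Q) = c \<cdot>\<^sub>m (P * (A * Q))" if "A \<in> UT n" for A c
    using mult_smult_assoc_mat[OF UT_carrier UT_carrier, OF that Q]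
      mult_smult_distrib[OF UT_carrier UT_carrier, OF P UT_mult, OF that Q] by simp
  ultimately show ?thesis
    unfolding UT_auto_def UT_linear_def by simp
qed

text \<open>The decomposition of \<open>A\<close> is the image under \<open>\<phi>\<close> of that
  of \<open>\<psi> A\<close>; uniqueness is pulled back along \<open>\<psi>\<close>.\<close>

lemma UT_grading_image:
  fixes G :: "('g, 'm) monoid_scheme" and R :: "'g \<Rightarrow> 'a::field mat set"
  assumes \<phi>: "UT_auto n \<phi> \<psi>" and gr: "graded_UT G n R"
  shows "UT_grading G n (\<lambda>g. \<phi> ` R g)"
proof -
  interpret graded_UT G n R by fact
  note U = UT_auto_UT[OF \<phi>] and I = UT_auto_inverse[OF \<phi>]
    and L = UT_linearD[OF UT_auto_linear[OF \<phi>]] and M = UT_auto_mult[OF \<phi>]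
  note L' = UT_auto_linear[OF UT_auto_sym[OF \<phi>]]
  have 0: "\<phi> (0\<^sub>m n n) = 0\<^sub>m n n"
    using UT_linear_zero[OF UT_auto_linear[OF \<phi>]] U UT_zero by blast
  have sub: "A \<in> \<phi> ` R g \<Longrightarrow> g \<in> carrier G \<Longrightarrow> A \<in> UT n \<and> \<psi> A \<in> R g" for A g
    using homog_UT U I by auto
  have memI: "\<psi> A \<in> R g \<Longrightarrow> A \<in> UT n \<Longrightarrow> A \<in> \<phi> ` R g" for A g
    using I by (metis imageI)
  have "\<exists>!a. a \<in> (\<Pi>\<^sub>E g\<in>carrier G. \<phi> ` R g) \<and> finsum (module_mat TYPE('a) n n) a (carrier G) = A"
    if A: "A \<in> UT n" for A
  proof (rule ex1I, rule conjI)
    let ?c = "\<lambda>g. \<phi> (component (\<psi> A) g)"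
    let ?a = "restrict ?c (carrier G)"
    have cU: "component (\<psi> A) g \<in> UT n" "?c g \<in> UT n" if "g \<in> carrier G" for g
      using component_UT U A that by auto
    have aU: "?a g \<in> UT n" if "g \<in> carrier G" for g using cU that by simp
    show "?a \<in> (\<Pi>\<^sub>E g\<in>carrier G. \<phi> ` R g)"
      using component_homog[OF U(2)[OF A]] by auto
    have "finsum (module_mat TYPE('a) n n) ?a (carrier G) = finsum (module_mat TYPE('a) n n) ?c (carrier G)"
    proof (rule UT_eqI)
      show "finsum (module_mat TYPE('a) n n) ?a (carrier G) \<in> UT n"
        "finsum (module_mat TYPE('a) n n) ?c (carrier G) \<in> UT n"
        using finsum_UT[OF fin, of ?a n] finsum_UT[OF fin, of ?c n] aU cU(2) by blast+
      have ac: "?a g \<in> carrier_mat n n" "?c g \<in> carrier_mat n n" if "g \<in> carrier G" for g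
        using aU[OF that] cU[OF that] by (auto dest: UT_carrier)
      fix i j assume "i \<le> j" "j < n"
      then show "finsum (module_mat TYPE('a) n n) ?a (carrier G) $$ (i,j) =
          finsum (module_mat TYPE('a) n n) ?c (carrier G) $$ (i,j)"
        using finsum_mat_index[OF fin, of ?a, OF ac(1)] finsum_mat_index[OF fin, of ?c, OF ac(2)]
        by (simp cong: sum.cong)
    qed
    also have "\<dots> = \<phi> (finsum (module_mat TYPE('a) n n) (component (\<psi> A)) (carrier G))"
      by (rule finsum_mat_linear[symmetric, OF UT_auto_linear[OF \<phi>] U(1) fin cU(1)])
    also have "\<dots> = A" using component_finsum U I A by simp
    finally show "finsum (module_mat TYPE('a) n n) ?a (carrier G) = A" .
    fix b assume b: "b \<in> (\<Pi>\<^sub>E g\<in>carrier G. \<phi> ` R g) \<and> finsum (module_mat TYPE('a) n n) b (carrier G) = A"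
    have bR: "b g \<in> UT n" "\<psi> (b g) \<in> R g" if "g \<in> carrier G" for g
      using b sub[of "b g" g] that by (auto simp: PiE_iff)
    have bc: "\<psi> (b g) \<in> carrier_mat n n" if "g \<in> carrier G" for g
      using bR[OF that] U by (blast intro: UT_carrier)
    have "\<psi> A = finsum (module_mat TYPE('a) n n) (\<lambda>g. \<psi> (b g)) (carrier G)"
      using finsum_mat_linear[OF L' U(2) fin, of b] bR b by blast
    then have "component (\<psi> A) g = \<psi> (b g)" if "g \<in> carrier G" for g
      using component_unique[OF U(2)[OF A], of "\<lambda>g. \<psi> (b g)"] bR that
        finsum_mat_index[OF fin, of "\<lambda>g. \<psi> (b g)", OF bc] by simp
    then show "b = ?a"
      using b bR I by (intro extensionalityI[of _ "carrier G"]) (auto simp: PiE_iff)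
  qed
  note direct_sum = this
  have add: "A + B \<in> \<phi> ` R g" if "A \<in> \<phi> ` R g" "B \<in> \<phi> ` R g" "g \<in> carrier G" for A B g
    using that sub memI UT_linearD(1)[OF L'] homog_add UT_add by metis
  have smult: "c \<cdot>\<^sub>m A \<in> \<phi> ` R g" if "A \<in> \<phi> ` R g" "g \<in> carrier G" for A g c
    using that sub memI UT_linearD(2)[OF L'] homog_smult UT_smult by metis
  have mult: "A * B \<in> \<phi> ` R (g \<otimes>\<^bsub>G\<^esub> h)"
    if "A \<in> \<phi> ` R g" "B \<in> \<phi> ` R h" "g \<in> carrier G" "h \<in> carrier G" for A B g h
    using that sub memI UT_auto_mult[OF UT_auto_sym[OF \<phi>]] homog_mult UT_mult by metis
  have zero: "0\<^sub>m n n \<in> \<phi> ` R g" if "g \<in> carrier G" for g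
    using 0 homog_zero[OF that] by (metis imageI)
  show ?thesis
    unfolding UT_grading_def
  proof (intro conjI ballI allI)
    show "\<phi> ` R g \<subseteq> UT n" if "g \<in> carrier G" for g using sub that by blast
  qed (simp_all only: direct_sum add smult mult zero)
qed

section \<open>Transport of degree-inverting involutions\<close>

locale graded_star_UT = graded_UT G n R
  for G :: "('g, 'm) monoid_scheme" (structure) and n and R :: "'g \<Rightarrow> 'a::field mat set" +
  fixes star :: "'a mat \<Rightarrow> 'a mat"
  assumes involution: "UT_involution n star" and inverting: "degree_inverting G R star"

lemma involutionD:
  assumes "UT_involution n star"
  shows "A \<in> UT n \<Longrightarrow> star A \<in> UT n" "UT_linear n star"
    "A \<in> UT n \<Longrightarrow> B \<in> UT n \<Longrightarrow> star (A * B) = star B * star A"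
    "A \<in> UT n \<Longrightarrow> star (star A) = A"
  using assms by (auto simp: UT_involution_def)

lemma transport:
  assumes \<phi>: "UT_auto n \<phi> \<psi>" and gr: "graded_star_UT G n R star"
  shows "graded_star_UT G n (\<lambda>g. \<phi> ` R g) (\<lambda>A. \<phi> (star (\<psi> A)))"
    and "UT_graded_star_iso G n R star (\<lambda>g. \<phi> ` R g) (\<lambda>A. \<phi> (star (\<psi> A))) \<phi>"
proof -
  interpret graded_star_UT G n R star by fact
  note U = UT_auto_UT[OF \<phi>] and I = UT_auto_inverse[OF \<phi>]
    and L = UT_linearD[OF UT_auto_linear[OF \<phi>]] and M = UT_auto_mult[OF \<phi>]
    and L' = UT_linearD[OF UT_auto_linear[OF UT_auto_sym[OF \<phi>]]]
    and M' = UT_auto_mult[OF UT_auto_sym[OF \<phi>]]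
    and S = involutionD[OF involution] and SL = UT_linearD[OF involutionD(2)[OF involution]]
  have "UT_involution n (\<lambda>A. \<phi> (star (\<psi> A)))"
    unfolding UT_involution_def UT_linear_def
    using U I L M L' M' S SL by simp
  moreover have "degree_inverting G (\<lambda>g. \<phi> ` R g) (\<lambda>A. \<phi> (star (\<psi> A)))"
    using inverting I homog_UT unfolding degree_inverting_def by fastforce
  moreover have "graded_UT G n (\<lambda>g. \<phi> ` R g)"
    using UT_grading_image[OF \<phi>] graded_UT_axioms fin
    by (auto intro!: graded_UT.intro graded_UT_axioms.intro comm_group_axioms)
  ultimately show "graded_star_UT G n (\<lambda>g. \<phi> ` R g) (\<lambda>A. \<phi> (star (\<psi> A)))"
    by (auto intro!: graded_star_UT.intro graded_star_UT_axioms.intro)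
  have "bij_betw \<phi> (UT n) (UT n)"
    by (rule bij_betw_byWitness[where f' = \<psi>]) (use U I in auto)
  then show "UT_graded_star_iso G n R star (\<lambda>g. \<phi> ` R g) (\<lambda>A. \<phi> (star (\<psi> A))) \<phi>"
    unfolding UT_graded_star_iso_def using UT_auto_linear[OF \<phi>] M I by auto
qed

lemma UT_graded_star_iso_trans:
  assumes "UT_graded_star_iso G n R1 s1 R2 s2 \<phi>" "UT_graded_star_iso G n R2 s2 R3 s3 \<psi>"
  shows "UT_graded_star_iso G n R1 s1 R3 s3 (\<psi> \<circ> \<phi>)"
proof -
  have "\<phi> A \<in> UT n" if "A \<in> UT n" for A
    using assms that by (auto simp: UT_graded_star_iso_def dest: bij_betwE)
  moreover have "bij_betw (\<psi> \<circ> \<phi>) (UT n) (UT n)"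
    using assms by (auto simp: UT_graded_star_iso_def intro: bij_betw_trans)
  ultimately show ?thesis
    using assms unfolding UT_graded_star_iso_def UT_linear_def by (simp add: image_subset_iff)
qed

section \<open>Elementary gradings\<close>

locale elementary_UT = graded_star_UT G n R star
  for G :: "('g, 'm) monoid_scheme" (structure) and n and R :: "'g \<Rightarrow> 'a::field mat set" and star +
  fixes d :: "nat \<Rightarrow> 'g"
  assumes deg_closed: "i < n \<Longrightarrow> d i \<in> carrier G"
    and unit_homog: "i \<le> j \<Longrightarrow> j < n \<Longrightarrow> mat_unit n i j \<in> R (inv (d i) \<otimes> d j)"
begin

lemma elementary: "elementary_grading G n d R"
  unfolding elementary_grading_def using grading unit_homog by simp

text \<open>Cutting with \<open>e_ii\<close> on the left and \<open>e_jj\<close> on the right, both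
  of degree \<open>\<one>\<close>, keeps the degree of \<open>A\<close> and leaves a nonzero
  multiple of \<open>e_ij\<close>. A nonzero matrix has at most one degree.\<close>

lemma homog_degree:
  assumes A: "A \<in> R g" and g: "g \<in> carrier G" and ij: "i \<le> j" "j < n" and nz: "A $$ (i,j) \<noteq> 0"
  shows "inv (d i) \<otimes> d j = g"
proof (rule ccontr)
  assume neq: "inv (d i) \<otimes> d j \<noteq> g"
  have i: "i < n" using ij by simp
  have e: "mat_unit n k k \<in> R \<one>" if "k < n" for k
    using unit_homog[of k k] deg_closed that by simp
  let ?X = "mat_unit n i i * (A * mat_unit n j j)"
  have AU: "A \<in> UT n" using A g homog_UT by blast
  have U: "A * mat_unit n j j \<in> UT n" using AU by (simp add: UT_mult mat_unit_UT)
  have X: "?X = A $$ (i,j) \<cdot>\<^sub>m mat_unit n i j"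
  proof (rule UT_eqI)
    fix k l assume "k \<le> l" "l < n"
    then show "?X $$ (k,l) = (A $$ (i,j) \<cdot>\<^sub>m mat_unit n i j) $$ (k,l)"
      using i ij
      by (auto simp: mat_unit_mult_index[OF UT_carrier[OF U]] mult_mat_unit_index[OF UT_carrier[OF AU]]
        mat_unit_index simp del: index_mult_mat)
  qed (use U ij in \<open>auto intro!: UT_mult UT_smult mat_unit_UT\<close>)
  have "?X \<in> R (\<one> \<otimes> (g \<otimes> \<one>))"
    by (intro homog_mult e i ij A) (use g in auto)
  then have "component ?X g = ?X" using component_of_homog g by simp
  moreover have "?X \<in> R (inv (d i) \<otimes> d j)"
    unfolding X by (intro homog_smult unit_homog ij) (use i ij deg_closed in auto)
  then have "component ?X g = 0\<^sub>m n n"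
    using component_of_homog neq g deg_closed i ij by simp
  ultimately have "(A $$ (i,j) \<cdot>\<^sub>m mat_unit n i j) $$ (i,j) = 0" using X i ij by simp
  then show False using nz i ij by (simp add: mat_unit_index)
qed

text \<open>Reduces degrees to positions of nonzero entries. This shows at once that diagonal
  matrices, and matrices assembled from columns of matrices of degree \<open>\<one>\<close>, have
  degree \<open>\<one>\<close>.\<close>

lemma homog_iff:
  assumes g: "g \<in> carrier G"
  shows "A \<in> R g \<longleftrightarrow> A \<in> UT n \<and> (\<forall>j<n. \<forall>i\<le>j. A $$ (i,j) \<noteq> 0 \<longrightarrow> inv (d i) \<otimes> d j = g)"
proof (intro iffI conjI allI impI)
  assume R: "A \<in> UT n \<and> (\<forall>j<n. \<forall>i\<le>j. A $$ (i,j) \<noteq> 0 \<longrightarrow> inv (d i) \<otimes> d j = g)"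
  then have A: "A \<in> UT n" by simp
  show "A \<in> R g"
  proof (rule homogI[OF A g])
    fix h assume h: "h \<in> carrier G" "h \<noteq> g"
    show "component A h = 0\<^sub>m n n"
    proof (rule UT_eqI[OF component_UT[OF A h(1)] UT_zero])
      fix i j assume ij: "i \<le> j" "j < n"
      have "component A h $$ (i,j) = 0"
      proof (rule ccontr)
        assume nz: "component A h $$ (i,j) \<noteq> 0"
        \<comment> \<open>A position belongs to a single degree, so no other component can cancel
          this entry, and it survives in \<open>A\<close>.\<close>
        have "component A k $$ (i,j) = 0" if "k \<in> carrier G" "k \<noteq> h" for k
          using homog_degree[OF component_homog[OF A] _ ij] nz h that by metis
        then have "A $$ (i,j) = (\<Sum>k\<in>carrier G. if k = h then component A h $$ (i,j) else 0)"
          unfolding component_sum[OF A le_less_trans[OF ij] ij(2)] by (intro sum.cong) auto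
        then have "A $$ (i,j) \<noteq> 0" using fin h nz by simp
        then show False
          using R ij homog_degree[OF component_homog[OF A h(1)] h(1) ij nz] h by blast
      qed
      then show "component A h $$ (i,j) = 0\<^sub>m n n $$ (i,j)" using ij by simp
    qed
  qed
qed (use g homog_UT homog_degree in blast)+

text \<open>Factors of degree \<open>\<one>\<close> leave the degrees of the matrix units unchanged,
  so the tuple \<open>d\<close> survives the conjugation.\<close>

lemma conj_degree_one:
  assumes P: "P \<in> R \<one>" "Q \<in> R \<one>" and inv: "P * Q = 1\<^sub>m n" "Q * P = 1\<^sub>m n"
  defines "R' \<equiv> \<lambda>g. (\<lambda>A. P * (A * Q)) ` R g" and "star' \<equiv> \<lambda>A. P * (star (Q * (A * P)) * Q)"
  shows "elementary_UT G n R' star' d"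
    and "UT_graded_star_iso G n R star R' star' (\<lambda>A. P * (A * Q))"
proof -
  have U: "P \<in> UT n" "Q \<in> UT n" using P homog_UT by auto
  note conj = UT_auto_conj[OF U inv]
  have "mat_unit n i j \<in> R' (inv (d i) \<otimes> d j)" if "i \<le> j" "j < n" for i j
  proof -
    have "Q * (mat_unit n i j * P) \<in> R (\<one> \<otimes> ((inv (d i) \<otimes> d j) \<otimes> \<one>))"
      by (intro homog_mult P unit_homog that) (use deg_closed that in auto)
    moreover have "mat_unit n i j = P * (Q * (mat_unit n i j * P) * Q)"
      using UT_auto_inverse(1)[OF conj mat_unit_UT[OF that(1)]] by simp
    ultimately show ?thesis unfolding R'_def using deg_closed that by simp
  qed
  moreover have "graded_star_UT G n R' star'"
    unfolding R'_def star'_def by (rule transport[OF conj graded_star_UT_axioms])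
  ultimately show "elementary_UT G n R' star' d"
    using deg_closed by (intro elementary_UT.intro elementary_UT_axioms.intro) auto
  show "UT_graded_star_iso G n R star R' star' (\<lambda>A. P * (A * Q))"
    unfolding R'_def star'_def by (rule transport[OF conj graded_star_UT_axioms])
qed

end

lemma (in graded_star_UT) isomorphic_elementary:
  "\<exists>R' star' d \<phi>. elementary_UT G n R' star' d \<and> UT_graded_star_iso G n R star R' star' \<phi>"
proof -
  obtain P Q d where P: "P \<in> UT n" "Q \<in> UT n" "P * Q = 1\<^sub>m n" "Q * P = 1\<^sub>m n"
    and d: "\<And>i. i < n \<Longrightarrow> d i \<in> carrier G"
    and e: "\<And>i j. i \<le> j \<Longrightarrow> j < n \<Longrightarrow> Q * (mat_unit n i j * P) \<in> R (inv (d i) \<otimes> d j)"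
    using conj_elementary by metis
  note conj = UT_auto_conj[OF P]
  let ?R = "\<lambda>g. (\<lambda>A. P * (A * Q)) ` R g" and ?star = "\<lambda>A. P * (star (Q * (A * P)) * Q)"
  have "mat_unit n i j \<in> ?R (inv (d i) \<otimes> d j)" if "i \<le> j" "j < n" for i j
    using UT_auto_inverse(1)[OF conj mat_unit_UT[OF that(1)]] e[OF that] by (metis (no_types, lifting) imageI)
  then have "elementary_UT G n ?R ?star d"
    using d transport(1)[OF conj graded_star_UT_axioms]
    by (intro elementary_UT.intro elementary_UT_axioms.intro) auto
  then show ?thesis using transport(2)[OF conj graded_star_UT_axioms] by blast
qed

section \<open>Involutions\<close>

lemma involution_minus:
  assumes "UT_involution n star" "A \<in> UT n" "B \<in> UT n"
  shows "star (A - B) = star A - star B"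
proof -
  note S = involutionD[OF assms(1)]
  have "star (A - B) = star A + (-1) \<cdot>\<^sub>m star B"
    unfolding UT_minus_conv[OF assms(2,3)]
    using UT_linearD[OF S(2)] assms UT_smult[of B n] by simp
  then show ?thesis using UT_minus_conv[OF S(1) S(1)] assms by metis
qed

lemma involution_zero:
  assumes "UT_involution n star" shows "star (0\<^sub>m n n) = 0\<^sub>m n n"
  using UT_linear_zero[OF involutionD(2)[OF assms]] involutionD(1)[OF assms UT_zero] by blast

lemma involution_one:
  assumes "UT_involution n star" shows "star (1\<^sub>m n) = 1\<^sub>m n"
proof -
  note S = involutionD[OF assms]
  have "star (1\<^sub>m n) = star (1\<^sub>m n) * star (star (1\<^sub>m n))"
    using S(1,4) UT_one UT_one_mult(2) by metis
  also have "\<dots> = star (star (1\<^sub>m n) * 1\<^sub>m n)"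
    using S(1,3) UT_one by metis
  also have "\<dots> = 1\<^sub>m n" using S(1,4) UT_one UT_one_mult(2) by metis
  finally show ?thesis .
qed

lemma involution_commutator:
  assumes "UT_involution n star" "B \<in> UT n" "C \<in> UT n"
  shows "star (B * C - C * B) = star C * star B - star B * star C"
  using assms involution_minus[OF assms(1)] involutionD(3)[OF assms(1)] UT_mult by metis

text \<open>An involution reverses products and maps commutators to commutators, so it turns the
  left annihilators of \<open>last_cols_Suc\<close> into the right annihilators of
  \<open>first_rows_Suc\<close>, and conversely.\<close>

lemma
  fixes star :: "'a::field mat \<Rightarrow> 'a mat"
  assumes star: "UT_involution n star" and m: "m \<le> n"
  shows involution_last_cols: "A \<in> last_cols n m \<Longrightarrow> star A \<in> first_rows n m"
    and involution_first_rows: "A \<in> first_rows n m \<Longrightarrow> star A \<in> last_cols n m"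
proof -
  note S = involutionD[OF star]
  have "(\<forall>A\<in>last_cols n m. star A \<in> first_rows n m) \<and> (\<forall>A\<in>first_rows n m. star A \<in> last_cols n m)"
    using m
  proof (induction m)
    case 0
    then show ?case using involution_zero[OF star] by (simp add: last_cols_0 first_rows_0)
  next
    case (Suc m)
    note IH = Suc.IH[OF Suc_leD[OF Suc.prems]]
    \<comment> \<open>Since \<open>star\<close> is its own inverse, every commutator is the image of
      a commutator.\<close>
    have comm: "B * C - C * B = star (star C * star B - star B * star C)"
      "star C * star B - star B * star C \<in> UT n" if "B \<in> UT n" "C \<in> UT n" for B C :: "'a mat"
      using involution_commutator[OF star S(1) S(1)] S(1,4) that by (simp, blast intro: UT_minus UT_mult S(1))
    show ?case
    proof (intro conjI ballI)
      fix A :: "'a mat" assume A: "A \<in> last_cols n (Suc m)"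
      then have AU: "A \<in> UT n"
        and H: "\<And>B C. B \<in> UT n \<Longrightarrow> C \<in> UT n \<Longrightarrow> A * (B * C - C * B) \<in> last_cols n m"
        using Suc.prems by (auto simp: last_cols_Suc)
      have "(B * C - C * B) * star A \<in> first_rows n m" if "B \<in> UT n" "C \<in> UT n" for B C
        using H[OF S(1) S(1), OF that(2,1)] IH S(3)[OF AU comm(2)[OF that]] comm(1)[OF that] by metis
      then show "star A \<in> first_rows n (Suc m)"
        using Suc.prems S(1)[OF AU] by (simp add: first_rows_Suc)
    next
      fix A :: "'a mat" assume A: "A \<in> first_rows n (Suc m)"
      then have AU: "A \<in> UT n"
        and H: "\<And>B C. B \<in> UT n \<Longrightarrow> C \<in> UT n \<Longrightarrow> (B * C - C * B) * A \<in> first_rows n m"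
        using Suc.prems by (auto simp: first_rows_Suc)
      have "star A * (B * C - C * B) \<in> last_cols n m" if "B \<in> UT n" "C \<in> UT n" for B C
        using H[OF S(1) S(1), OF that(2,1)] IH S(3)[OF comm(2)[OF that] AU] comm(1)[OF that] by metis
      then show "star A \<in> last_cols n (Suc m)"
        using Suc.prems S(1)[OF AU] by (simp add: last_cols_Suc)
    qed
  qed
  then show "A \<in> last_cols n m \<Longrightarrow> star A \<in> first_rows n m"
    "A \<in> first_rows n m \<Longrightarrow> star A \<in> last_cols n m" by auto
qed

text \<open>The support of \<open>f\<close> meets in its product with itself only at the middle
  index \<open>k\<close>, so \<open>f * f = f\<close> says that \<open>f\<close> is its column
  \<open>k\<close> times its row \<open>k\<close>. The entry at \<open>(k,k)\<close> is then an
  idempotent scalar, and it is nonzero because \<open>f\<close> is.\<close>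

lemma involution_mat_unit:
  fixes star :: "'a::field mat \<Rightarrow> 'a mat"
  assumes star: "UT_involution n star" and k: "k < n"
  defines "f \<equiv> star (mat_unit n (n - 1 - k) (n - 1 - k))"
  shows "f $$ (k,k) = 1" and "\<And>i j. i < n \<Longrightarrow> j < n \<Longrightarrow> k < i \<or> j < k \<Longrightarrow> f $$ (i,j) = 0"
proof -
  let ?k = "n - 1 - k"
  let ?e = "mat_unit n ?k ?k :: 'a mat"
  note S = involutionD[OF star]
  have e: "?e \<in> UT n" by (simp add: mat_unit_UT)
  have f: "f \<in> UT n" unfolding f_def using S(1) e by blast
  \<comment> \<open>Counting from \<open>0\<close>, column \<open>n - 1 - k\<close> is the first of
    the last \<open>k + 1\<close> columns and row \<open>n - 1 - k\<close> is the last of the first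
    \<open>n - k\<close> rows.\<close>
  have "?e \<in> last_cols n (Suc k)" "?e \<in> first_rows n (n - k)"
    using e k by (auto simp: last_cols_def first_rows_def mat_unit_index)
  then have "f \<in> first_rows n (Suc k)" "f \<in> last_cols n (n - k)"
    unfolding f_def using k involution_last_cols[OF star] involution_first_rows[OF star] by auto
  then show supp: "\<And>i j. i < n \<Longrightarrow> j < n \<Longrightarrow> k < i \<or> j < k \<Longrightarrow> f $$ (i,j) = 0"
    using k by (auto simp: first_rows_def last_cols_def)
  have "?e * ?e = ?e" using k by (subst mat_unit_mult) auto
  then have "f * f = f" unfolding f_def using S(3)[OF e e] by simp
  have idem: "f $$ (i,j) = f $$ (i,k) * f $$ (k,j)" if "i < n" "j < n" for i j
  proof -
    have "(\<Sum>l<n. f $$ (i,l) * f $$ (l,j)) = (\<Sum>l\<in>{k}. f $$ (i,l) * f $$ (l,j))"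
      using k supp that by (intro sum.mono_neutral_right) (auto simp: neq_iff)
    then show ?thesis
      using mult_index[OF UT_carrier[OF f] UT_carrier[OF f] that] \<open>f * f = f\<close> by simp
  qed
  have "f $$ (k,k) \<noteq> 0"
  proof
    assume "f $$ (k,k) = 0"
    then have "f $$ (i,k) = 0" if "i < n" for i using idem[OF that k] by simp
    then have "f = 0\<^sub>m n n"
      by (intro UT_eqI[OF f UT_zero]) (simp add: idem)
    then have "?e = 0\<^sub>m n n"
      using S(4)[OF e] involution_zero[OF star] unfolding f_def by simp
    then have "?e $$ (?k,?k) = 0" using k by simp
    then show False using k by (simp add: mat_unit_index)
  qed
  then show "f $$ (k,k) = 1" using idem[OF k k] by simp
qed

section \<open>Square roots of unipotent matrices\<close>

text \<open>Newton's iteration \<open>w \<mapsto> w - (w\<^sup>2 - t)/2\<close>, started at \<open>1\<close>, gains one superdiagonal in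
  each step. It stays inside every set of matrices closed under linear combinations and squares.\<close>

lemma unipotent_sqrt:
  fixes t :: "'a::field_char_0 mat"
  assumes S: "S \<subseteq> UT n" "1\<^sub>m n \<in> S" "t \<in> S"
    and add: "\<And>A B. A \<in> S \<Longrightarrow> B \<in> S \<Longrightarrow> A + B \<in> S"
    and smult: "\<And>A c. A \<in> S \<Longrightarrow> c \<cdot>\<^sub>m A \<in> S"
    and square: "\<And>A. A \<in> S \<Longrightarrow> A * A \<in> S"
    and diag: "\<And>i. i < n \<Longrightarrow> t $$ (i,i) = 1"
  shows "\<exists>w\<in>S. w * w = t \<and> (\<forall>i<n. w $$ (i,i) = 1)"
proof -
  have "\<exists>w\<in>S. (\<forall>i<n. w $$ (i,i) = 1) \<and>
    (\<forall>i j. i \<le> j \<longrightarrow> j < n \<longrightarrow> j \<le> i + m \<longrightarrow> (w * w) $$ (i,j) = t $$ (i,j))" for m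
  proof (induction m)
    case 0
    show ?case using S diag by (intro bexI[of _ "1\<^sub>m n"]) auto
  next
    case (Suc m)
    then obtain w where w: "w \<in> S" "\<forall>i<n. w $$ (i,i) = 1"
      and eq: "\<And>i j. i \<le> j \<Longrightarrow> j < n \<Longrightarrow> j \<le> i + m \<Longrightarrow> (w * w) $$ (i,j) = t $$ (i,j)"
      by metis
    define q where "q = w * w + (-1) \<cdot>\<^sub>m t"
    define v where "v = w + (-1/2) \<cdot>\<^sub>m q"
    have q: "q \<in> S" and v: "v \<in> S" unfolding q_def v_def using S w by (auto intro!: add smult square)
    have U: "w \<in> UT n" "t \<in> UT n" "q \<in> UT n" "v \<in> UT n" using S w q v by auto
    have qi: "q $$ (i,j) = (w * w) $$ (i,j) - t $$ (i,j)" if "i < n" "j < n" for i j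
      using that U(1,2) by (simp add: q_def UT_dim[OF U(1)] UT_dim[OF U(2)] del: index_mult_mat(1))
    have vi: "v $$ (i,j) = w $$ (i,j) - q $$ (i,j) / 2" if "i < n" "j < n" for i j
      using that U by (simp add: v_def UT_dim[OF U(1)] UT_dim[OF U(3)])
    have q0: "q $$ (i,j) = 0" if "i < n" "j < n" "j \<le> i + m" for i j
      using that eq qi UT_lower[OF U(3)] by (cases "i \<le> j") auto
    \<comment> \<open>Up to superdiagonal \<open>m + 1\<close>, \<open>w * q\<close> and
      \<open>q * w\<close> both equal \<open>q\<close> because \<open>w\<close> has unit diagonal,
      and \<open>q * q\<close> vanishes. So subtracting half of \<open>q\<close> from
      \<open>w\<close> removes exactly \<open>q\<close> from the square.\<close>
    have "(v * v) $$ (i,j) = t $$ (i,j)" if ij: "i \<le> j" "j < n" "j \<le> i + Suc m" for i j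
    proof -
      have "(\<Sum>k=i..j. w $$ (i,k) * q $$ (k,j)) = (\<Sum>k\<in>{i}. w $$ (i,k) * q $$ (k,j))"
        using ij by (intro sum.mono_neutral_right) (auto intro!: q0)
      then have wq: "(\<Sum>k=i..j. w $$ (i,k) * q $$ (k,j)) = q $$ (i,j)" using w ij by simp
      have "(\<Sum>k=i..j. q $$ (i,k) * w $$ (k,j)) = (\<Sum>k\<in>{j}. q $$ (i,k) * w $$ (k,j))"
        using ij by (intro sum.mono_neutral_right) (auto intro!: q0)
      then have qw: "(\<Sum>k=i..j. q $$ (i,k) * w $$ (k,j)) = q $$ (i,j)" using w ij by simp
      have qq: "(\<Sum>k=i..j. q $$ (i,k) * q $$ (k,j)) = 0"
      proof (rule sum.neutral, rule ballI)
        fix k assume "k \<in> {i..j}"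
        then show "q $$ (i,k) * q $$ (k,j) = 0"
          using ij q0[of i k] q0[of k j] by (cases "k = i") auto
      qed
      have "(v * v) $$ (i,j) = (\<Sum>k=i..j. w $$ (i,k) * w $$ (k,j) - w $$ (i,k) * q $$ (k,j) / 2
          - q $$ (i,k) * w $$ (k,j) / 2 + q $$ (i,k) * q $$ (k,j) / 4)"
        unfolding UT_mult_index[OF U(4) U(4) ij(1,2)]
        using ij by (intro sum.cong) (auto simp: vi field_simps)
      also have "\<dots> = (w * w) $$ (i,j) - q $$ (i,j)"
        unfolding UT_mult_index[OF U(1) U(1) ij(1,2)]
        by (simp add: sum.distrib sum_subtractf sum_divide_distrib[symmetric] wq qw qq)
      also have "\<dots> = t $$ (i,j)" using qi ij by simp
      finally show ?thesis .
    qed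
    moreover have "v $$ (i,i) = 1" if "i < n" for i
      using that vi q0 w by simp
    ultimately show ?case using v by blast
  qed
  from this[of n] obtain w where w: "w \<in> S" "\<forall>i<n. w $$ (i,i) = 1"
    and eq: "\<And>i j. i \<le> j \<Longrightarrow> j < n \<Longrightarrow> (w * w) $$ (i,j) = t $$ (i,j)"
    by (metis less_imp_le_nat trans_le_add2)
  have "w * w = t" using S w by (intro UT_eqI[of _ n] UT_mult eq) auto
  with w show ?thesis by blast
qed

context elementary_UT
begin

lemmas star_UT = involutionD(1)[OF involution]
  and star_linear = UT_linearD[OF involutionD(2)[OF involution]]
  and star_mult = involutionD(3)[OF involution]
  and star_star = involutionD(4)[OF involution]

lemma star_homog: "A \<in> R g \<Longrightarrow> g \<in> carrier G \<Longrightarrow> star A \<in> R (inv g)"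
  using inverting unfolding degree_inverting_def by blast

end

text \<open>Conjugation with \<open>t\<close> itself carries the idempotents \<open>e k\<close> into the \<open>f k\<close>; conjugation with a
  symmetric square root of \<open>t\<close> meets halfway, in a system of idempotents that the involution permutes.\<close>

lemma isomorphic_reversing:
  fixes G :: "('g, 'm) monoid_scheme" and R :: "'g \<Rightarrow> 'a::field_char_0 mat set"
  assumes "elementary_UT G n R star d"
  shows "\<exists>R' star' \<phi>. elementary_UT G n R' star' d \<and> UT_graded_star_iso G n R star R' star' \<phi> \<and>
    (\<forall>k<n. star' (mat_unit n k k) = mat_unit n (n - 1 - k) (n - 1 - k))"
proof -
  interpret elementary_UT G n R star d by fact
  let ?e = "\<lambda>k. mat_unit n k k :: 'a mat"
  define f where "f k = star (?e (n - 1 - k))" for k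
  define t where "t = mat n n (\<lambda>(k,l). f l $$ (k,l))"
  have e: "?e k \<in> UT n" for k by (simp add: mat_unit_UT)
  have f: "f k \<in> UT n" for k unfolding f_def using star_UT e by blast
  have eR: "?e k \<in> R \<one>\<^bsub>G\<^esub>" if "k < n" for k
    using unit_homog[of k k] deg_closed that by simp
  have fR: "f k \<in> R \<one>\<^bsub>G\<^esub>" if "k < n" for k
    unfolding f_def using star_homog[OF eR, of "n - 1 - k"] that by simp
  have sf: "star (f k) = ?e (n - 1 - k)" for k unfolding f_def using star_star e by blast
  have f_diag: "f k $$ (k,k) = 1" if "k < n" for k
    unfolding f_def using involution_mat_unit(1)[OF involution that] .
  have t: "t \<in> UT n" using UT_lower[OF f] by (auto simp: UT_iff t_def)
  have t_index: "t $$ (i,j) = f j $$ (i,j)" if "i < n" "j < n" for i j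
    using that by (simp add: t_def)
  \<comment> \<open>Column \<open>l\<close> of \<open>t\<close> is column \<open>l\<close> of
    \<open>f l\<close>, which has degree \<open>\<one>\<close>.\<close>
  have tR: "t \<in> R \<one>\<^bsub>G\<^esub>"
    using t fR by (auto simp: homog_iff t_index)
  have te: "t * ?e k = f k * ?e k" if "k < n" for k
  proof (rule UT_eqI[OF UT_mult[OF t e] UT_mult[OF f e]])
    fix i j assume "i \<le> j" "j < n"
    then show "(t * ?e k) $$ (i,j) = (f k * ?e k) $$ (i,j)"
      using that by (simp add: mult_mat_unit_index[OF UT_carrier[OF t]]
        mult_mat_unit_index[OF UT_carrier[OF f]] t_index del: index_mult_mat)
  qed
  have ff: "f k * f l = (if k = l then f k else 0\<^sub>m n n)" if "k < n" "l < n" for k l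
  proof -
    have "f k * f l = star (?e (n - 1 - l) * ?e (n - 1 - k))"
      unfolding f_def using star_mult e by metis
    then show ?thesis
      using that involution_zero[OF involution] by (auto simp: mat_unit_mult f_def)
  qed
  \<comment> \<open>Column \<open>j\<close> of \<open>f k * t\<close> is column \<open>j\<close> of
    \<open>f k * f j\<close>, which vanishes unless \<open>j = k\<close> by orthogonality of the
    idempotents.\<close>
  have ft: "f k * t = t * ?e k" if k: "k < n" for k
  proof (rule UT_eqI[OF UT_mult[OF f t] UT_mult[OF t e]])
    fix i j assume ij: "i \<le> j" "j < n"
    have "(f k * t) $$ (i,j) = (f k * t * ?e j) $$ (i,j)"
      using ij mult_mat_unit_index[OF UT_carrier[OF UT_mult[OF f[of k] t]], of i j j j] by simp
    also have "f k * t * ?e j = f k * f j * ?e j"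
      using te[OF ij(2)] UT_mult_assoc[OF f t e] UT_mult_assoc[OF f f e] by simp
    also have "\<dots> $$ (i,j) = (t * ?e k) $$ (i,j)"
      using ij k ff[OF k ij(2)] mult_mat_unit_index[OF UT_carrier[OF f[of k]], of i j j j]
        mult_mat_unit_index[OF UT_carrier[OF t], of i j k k] e[of j]
      by (auto simp: UT_mult_zero t_index simp del: index_mult_mat)
    finally show "(f k * t) $$ (i,j) = (t * ?e k) $$ (i,j)" .
  qed
  note assoc = UT_mult_assoc[where n = n] UT_mult[where n = n]
  obtain s where s: "s \<in> UT n" "t * s = 1\<^sub>m n" "s * t = 1\<^sub>m n"
    using UT_unit[OF t] f_diag t_index by (metis one_neq_zero)
  \<comment> \<open>It suffices that every \<open>f k\<close> kills \<open>star t - t\<close>: as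
    \<open>s * f k = ?e k * s\<close>, row \<open>k\<close> of \<open>s * (star t - t)\<close> then
    vanishes for every \<open>k\<close>, and \<open>s\<close> is invertible.\<close>
  have st: "star t = t"
  proof -
    have stU: "star t \<in> UT n" using star_UT t by blast
    let ?y = "star t - t"
    have y: "?y \<in> UT n" using stU t by (rule UT_minus)
    have sy: "s * ?y \<in> UT n" using s(1) y by (rule UT_mult)
    have "(s * ?y) $$ (k,l) = 0" if kl: "k \<le> l" "l < n" for k l
    proof -
      have k: "k < n" and k': "n - 1 - k < n" using kl by auto
      \<comment> \<open>Under \<open>star\<close> the factors of \<open>t * ?e = f * ?e\<close> at
        the reflected index swap roles, giving \<open>f k * ?e k\<close>.\<close>
      have "f k * star t = star (t * ?e (n - 1 - k))"
        unfolding f_def using star_mult t e by simp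
      also have "\<dots> = f k * star (f (n - 1 - k))"
        unfolding te[OF k'] f_def[of k] using star_mult f e by simp
      also have "\<dots> = f k * t"
        using sf[of "n - 1 - k"] te[OF k] ft[OF k] k by simp
      finally have "f k * ?y = 0\<^sub>m n n"
        using mult_minus_distrib_mat[OF UT_carrier UT_carrier UT_carrier, OF f stU t]
          UT_carrier[OF UT_mult[OF f t]] by simp
      moreover have "s * f k = ?e k * s"
      proof -
        have "s * f k = s * (f k * t) * s"
          using s f[of k] t by (simp add: assoc UT_one_mult[where n = n])
        also have "\<dots> = ?e k * s"
          unfolding ft[OF k] using UT_mult_cancel[OF s(1) t e s(3)] by simp
        finally show ?thesis .
      qed
      ultimately have "?e k * (s * ?y) = 0\<^sub>m n n"
        using UT_mult_assoc[OF e[of k] s(1) y] UT_mult_assoc[OF s(1) f[of k] y] s(1)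
        by (metis UT_mult_zero(1))
      then show ?thesis
        using mat_unit_mult_index[OF UT_carrier[OF sy] k kl(2) k, of k] k kl(2) by simp
    qed
    then have "s * ?y = 0\<^sub>m n n" by (intro UT_eqI[OF sy UT_zero]) simp
    then have y0: "?y = 0\<^sub>m n n"
      using UT_mult_cancel[OF t s(1) y s(2)] t by (simp add: UT_mult_zero)
    show ?thesis
    proof (rule UT_eqI[OF stU t])
      fix i j assume "i \<le> j" "j < n"
      then have "?y $$ (i,j) = star t $$ (i,j) - t $$ (i,j)" using UT_dim[OF t] by simp
      then show "star t $$ (i,j) = t $$ (i,j)" using \<open>i \<le> j\<close> \<open>j < n\<close> unfolding y0 by simp
    qed
  qed
  \<comment> \<open>Products of symmetric matrices need not be symmetric, but squares and linear
    combinations are; this explains the closure conditions in \<open>unipotent_sqrt\<close>.\<close>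
  let ?S = "{A \<in> R \<one>\<^bsub>G\<^esub>. star A = A}"
  have SU: "A \<in> UT n" if "A \<in> ?S" for A using that homog_UT by auto
  have sub: "?S \<subseteq> UT n" using SU by blast
  have add: "A + B \<in> ?S" if "A \<in> ?S" "B \<in> ?S" for A B
    using that homog_add star_linear(1) SU by auto
  have smult: "c \<cdot>\<^sub>m A \<in> ?S" if "A \<in> ?S" for A c
    using that homog_smult star_linear(2) SU by auto
  have square: "A * A \<in> ?S" if "A \<in> ?S" for A
    using that homog_mult[of A "\<one>\<^bsub>G\<^esub>" A "\<one>\<^bsub>G\<^esub>"] star_mult SU by auto
  have one_t: "1\<^sub>m n \<in> ?S" "t \<in> ?S"
    using one_homog involution_one[OF involution] tR st by auto
  have t_diag: "t $$ (i,i) = 1" if "i < n" for i using f_diag t_index that by simp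
  have "\<exists>w\<in>?S. w * w = t \<and> (\<forall>i<n. w $$ (i,i) = 1)"
    by (rule unipotent_sqrt[OF sub one_t add smult square t_diag])
  then obtain w where w: "w \<in> ?S" "w * w = t" "\<And>i. i < n \<Longrightarrow> w $$ (i,i) = 1"
    by blast
  have wU: "w \<in> UT n" using SU w(1) .
  obtain v where v: "v \<in> UT n" "w * v = 1\<^sub>m n" "v * w = 1\<^sub>m n"
    using UT_unit[OF wU] w(3) by (metis one_neq_zero)
  have wR: "w \<in> R \<one>\<^bsub>G\<^esub>" and sw: "star w = w" using w(1) by auto
  have vR: "v \<in> R \<one>\<^bsub>G\<^esub>" using inverse_homog[OF wR v] .
  have sv: "star v = v"
  proof -
    have "star v * w = 1\<^sub>m n"
      using star_mult[OF wU v(1)] sw v(2) involution_one[OF involution] by simp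
    then have "star v * w * v = v" using v(1) by (simp add: UT_one_mult)
    then show ?thesis
      using UT_mult_assoc[OF star_UT[OF v(1)] wU v(1)] v star_UT[OF v(1)] by (simp add: UT_one_mult)
  qed
  \<comment> \<open>Symmetry of \<open>v\<close> and \<open>w\<close> turns the left side into
    \<open>f (n - 1 - k)\<close> between \<open>v * v\<close> and \<open>w * w = t\<close>, that is,
    into its conjugate by the inverse of \<open>t\<close>.\<close>
  have "v * (star (w * (?e k * v)) * w) = ?e (n - 1 - k)" if k: "k < n" for k
  proof -
    let ?f = "star (?e k)"
    have fk: "?f = f (n - 1 - k)" "n - 1 - k < n" unfolding f_def using k by simp_all
    have fU: "?f \<in> UT n" using star_UT e by blast
    have "star (w * (?e k * v)) = v * (?f * w)"
      using star_mult[OF wU UT_mult[OF e v(1)]] star_mult[OF e v(1)] sv sw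
        UT_mult_assoc[OF v(1) fU wU] by simp
    moreover have "v * (?f * w) * w = v * (?f * t)"
      using wU v(1) fU by (simp add: assoc w(2)[symmetric])
    moreover have "v * (v * (w * (w * ?e (n - 1 - k)))) = ?e (n - 1 - k)"
      using wU v e by (simp add: assoc UT_mult_cancel)
    ultimately show ?thesis
      using ft[OF fk(2)] fk(1) UT_mult_assoc[OF wU wU e] w(2) by simp
  qed
  then show ?thesis
    using conj_degree_one[OF vR wR v(3,2)] by blast
qed

section \<open>The canonical involutions\<close>

lemma exchange_mat_index:
  "i < n \<Longrightarrow> j < n \<Longrightarrow> exchange_mat n $$ (i,j) = (if j = n - 1 - i then 1 else 0)"
  by (simp add: exchange_mat_def)

lemma inv_circ_index:
  assumes A: "A \<in> carrier_mat n n" and ij: "i < n" "j < n"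
  shows "inv_circ n A $$ (i,j) = A $$ (n - 1 - j, n - 1 - i)"
proof -
  let ?S = "exchange_mat n :: 'a mat"
  have S: "?S \<in> carrier_mat n n" by (simp add: exchange_mat_def)
  have T: "transpose_mat A \<in> carrier_mat n n" using A by simp
  have ST: "?S * transpose_mat A \<in> carrier_mat n n" using S T by simp
  have ST_index: "(?S * transpose_mat A) $$ (i,k) = A $$ (k, n - 1 - i)" if "k < n" for k
  proof -
    have "(?S * transpose_mat A) $$ (i,k) = (\<Sum>l<n. if l = n - 1 - i then A $$ (k,l) else 0)"
      unfolding mult_index[OF S T ij(1) that]
      using A ij that by (intro sum.cong) (auto simp: exchange_mat_index)
    then show ?thesis using ij by simp
  qed
  have "inv_circ n A $$ (i,j) = (\<Sum>k<n. if k = n - 1 - j then A $$ (k, n - 1 - i) else 0)"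
    unfolding inv_circ_def mult_index[OF ST S ij]
    using ij by (intro sum.cong) (auto simp: ST_index exchange_mat_index)
  then show "inv_circ n A $$ (i,j) = A $$ (n - 1 - j, n - 1 - i)" using ij by simp
qed

lemma inv_circ_UT: "A \<in> UT n \<Longrightarrow> inv_circ n A \<in> UT n"
  using inv_circ_index[OF UT_carrier, of A n] by (auto simp: UT_iff inv_circ_def exchange_mat_def)

lemma sign_mat_eq: "sign_mat m = mat_diag (2 * m) (\<lambda>i. if i < m then 1 else - 1)"
  by (rule eq_matI) (auto simp: sign_mat_def mat_diag_def)

lemma inv_s_index:
  assumes A: "A \<in> carrier_mat (2 * m) (2 * m)" and ij: "i < 2 * m" "j < 2 * m"
  shows "inv_s m A $$ (i,j) =
    (if i < m then 1 else - 1) * A $$ (2 * m - 1 - j, 2 * m - 1 - i) * (if j < m then 1 else - 1)"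
proof -
  have C: "inv_circ (2 * m) A \<in> carrier_mat (2 * m) (2 * m)"
    by (auto simp: inv_circ_def exchange_mat_def)
  then have "sign_mat m * inv_circ (2 * m) A \<in> carrier_mat (2 * m) (2 * m)"
    by (simp add: sign_mat_eq mat_diag_mult_left)
  then show ?thesis
    using ij inv_circ_index[OF A ij] C
    by (simp add: inv_s_def sign_mat_eq mat_diag_mult_left[of _ "2 * m" "2 * m"]
        mat_diag_mult_right[of _ "2 * m" "2 * m"])
qed

lemma inv_s_UT: "A \<in> UT (2 * m) \<Longrightarrow> inv_s m A \<in> UT (2 * m)"
proof -
  assume A: "A \<in> UT (2 * m)"
  have "dim_row (inv_s m A) = 2 * m" "dim_col (inv_s m A) = 2 * m"
    by (simp_all add: inv_s_def sign_mat_eq mat_diag_def)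
  then show ?thesis
    using inv_s_index[OF UT_carrier[OF A]] UT_lower[OF A] by (auto simp: UT_iff)
qed

section \<open>Rescaling the matrix units\<close>

locale reversing_UT = elementary_UT G n R star d
  for G :: "('g, 'm) monoid_scheme" (structure) and n and R :: "'g \<Rightarrow> 'a::field mat set"
    and star and d +
  assumes reversing: "k < n \<Longrightarrow> star (mat_unit n k k) = mat_unit n (n - 1 - k) (n - 1 - k)"
begin

abbreviation opp :: "nat \<Rightarrow> nat" where "opp i \<equiv> n - 1 - i"

text \<open>The scalar relating \<open>star e_ij\<close> to the reflected matrix unit, read off at
  the only position where \<open>star e_ij\<close> can be nonzero.\<close>

definition coef :: "nat \<Rightarrow> nat \<Rightarrow> 'a" where
  "coef i j = star (mat_unit n i j) $$ (opp j, opp i)"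

text \<open>Apply \<open>star\<close> to the identity expressing \<open>e_ii A e_jj\<close> as a
  multiple of \<open>e_ij\<close>: the two idempotents are reflected and change sides.\<close>

lemma star_index:
  assumes A: "A \<in> UT n" and ij: "i \<le> j" "j < n"
  shows "star A $$ (opp j, opp i) = coef i j * A $$ (i,j)"
proof -
  have i: "i < n" using ij by simp
  let ?e = "\<lambda>k. mat_unit n k k :: 'a mat"
  have e: "?e k \<in> UT n" for k by (simp add: mat_unit_UT)
  have sA: "star A \<in> UT n" using star_UT A .
  have Ae: "A * ?e j \<in> UT n" using A e by (rule UT_mult)
  have sAe: "star A * ?e (opp i) \<in> UT n" using sA e by (rule UT_mult)
  have X: "?e i * (A * ?e j) = A $$ (i,j) \<cdot>\<^sub>m mat_unit n i j"
  proof (rule UT_eqI)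
    fix k l assume "k \<le> l" "l < n"
    then show "(?e i * (A * ?e j)) $$ (k,l) = (A $$ (i,j) \<cdot>\<^sub>m mat_unit n i j) $$ (k,l)"
      using i ij by (auto simp: mat_unit_mult_index[OF UT_carrier[OF Ae]]
        mult_mat_unit_index[OF UT_carrier[OF A]] mat_unit_index simp del: index_mult_mat)
  qed (use Ae e ij in \<open>auto intro!: UT_mult UT_smult mat_unit_UT\<close>)
  have "star (?e i * (A * ?e j)) = ?e (opp j) * (star A * ?e (opp i))"
    using star_mult[OF e Ae] star_mult[OF A e] reversing i ij UT_mult_assoc[OF e sA e] by simp
  then have "?e (opp j) * (star A * ?e (opp i)) = A $$ (i,j) \<cdot>\<^sub>m star (mat_unit n i j)"
    unfolding X using star_linear(2)[OF mat_unit_UT[OF ij(1)]] by simp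
  then have "(?e (opp j) * (star A * ?e (opp i))) $$ (opp j, opp i) = A $$ (i,j) * coef i j"
    using i ij UT_dim[OF star_UT[OF mat_unit_UT[OF ij(1)]]] by (simp add: coef_def)
  moreover have "(?e (opp j) * (star A * ?e (opp i))) $$ (opp j, opp i) = star A $$ (opp j, opp i)"
    using i ij mat_unit_mult_index[OF UT_carrier[OF sAe], of "opp j" "opp i" "opp j" "opp j"]
      mult_mat_unit_index[OF UT_carrier[OF sA], of "opp j" "opp i" "opp i" "opp i"] by simp
  ultimately show ?thesis by (simp add: mult.commute)
qed

text \<open>Comes from applying \<open>star\<close> twice; in particular no \<open>coef\<close>
  vanishes.\<close>

lemma coef_opp:
  assumes "i \<le> j" "j < n"
  shows "coef (opp j) (opp i) * coef i j = 1"
proof -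
  let ?E = "mat_unit n i j :: 'a mat"
  have E: "?E \<in> UT n" using assms by (simp add: mat_unit_UT)
  have "star (star ?E) $$ (opp (opp i), opp (opp j)) = coef (opp j) (opp i) * (coef i j * ?E $$ (i,j))"
    using star_index[OF star_UT[OF E], of "opp j" "opp i"] star_index[OF E assms] assms by simp
  then show ?thesis using star_star[OF E] assms by (simp add: mat_unit_index)
qed

text \<open>The cocycle identity, from \<open>star\<close> applied to
  \<open>e_ij e_jk = e_ik\<close>.\<close>

lemma coef_mult:
  assumes "i \<le> j" "j \<le> k" "k < n"
  shows "coef i j * coef j k = coef i k"
proof -
  let ?E = "mat_unit n i j :: 'a mat" and ?F = "mat_unit n j k :: 'a mat"
  have E: "?E \<in> UT n" "?F \<in> UT n" using assms by (auto simp: mat_unit_UT)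
  have sE: "star ?E $$ (m, opp i) = (if m = opp j then coef i j else 0)" if "m \<le> opp i" "m < n" for m
    using star_index[OF E(1), of i "opp m"] assms that by (auto simp: mat_unit_index)
  have sF: "star ?F $$ (opp k, opp j) = coef j k"
    using star_index[OF E(2), of j k] assms by (simp add: mat_unit_index)
  have "coef i k = star (?E * ?F) $$ (opp k, opp i)"
    using assms by (simp add: mat_unit_mult coef_def)
  also have "\<dots> = (star ?F * star ?E) $$ (opp k, opp i)" using star_mult E by simp
  also have "\<dots> = (\<Sum>m=opp k..opp i. star ?F $$ (opp k, m) * star ?E $$ (m, opp i))"
    using UT_mult_index[OF star_UT[OF E(2)] star_UT[OF E(1)], of "opp k" "opp i"] assms by simp
  also have "\<dots> = (\<Sum>m=opp k..opp i. if m = opp j then coef j k * coef i j else 0)"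
  proof (rule sum.cong[OF refl])
    fix m assume "m \<in> {opp k..opp i}"
    then have "m \<le> opp i" "m < n" using assms by auto
    then show "star ?F $$ (opp k, m) * star ?E $$ (m, opp i) = (if m = opp j then coef j k * coef i j else 0)"
      using sE[of m] sF by (cases "m = opp j") simp_all
  qed
  finally have eq: "coef i k = \<dots>" .
  have "n - Suc k \<le> n - Suc j" "n - Suc j \<le> n - Suc i" using assms by auto
  then have "(\<Sum>m=opp k..opp i. if m = opp j then coef j k * coef i j else 0) = coef i j * coef j k"
    by simp
  then show ?thesis using eq by simp
qed

text \<open>A potential of the cocycle: its quotients recover \<open>coef\<close>, so it determines
  the involution.\<close>

definition weight :: "nat \<Rightarrow> 'a" where "weight i = coef 0 i"

lemma weight_nonzero: "i < n \<Longrightarrow> weight i \<noteq> 0"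
  using coef_opp[of 0 i] by (auto simp: weight_def)

lemma coef_eq: "i \<le> j \<Longrightarrow> j < n \<Longrightarrow> coef i j = weight j / weight i"
  using coef_mult[of 0 i j] weight_nonzero[of i] by (simp add: weight_def field_simps)

text \<open>Rewriting \<open>coef_opp\<close> through the potential shows that the ratio of the
  weights at opposite indices is constant.\<close>

lemma weight_opp:
  assumes "i < n" "j < n"
  shows "weight (opp i) * weight j = weight (opp j) * weight i"
proof -
  have "weight (opp i) * weight j = weight (opp j) * weight i" if "i \<le> j" "j < n" for i j
    using coef_opp[OF that] coef_eq[OF that] coef_eq[of "opp j" "opp i"] that
      weight_nonzero[of i] weight_nonzero[of "opp j"] by (simp add: field_simps)
  from this[of i j] this[of j i] show ?thesis using assms by (cases "i \<le> j") auto
qed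

text \<open>\<open>e_ij\<close> and its reflection have inverse degrees, since
  \<open>star e_ij\<close> is nonzero at the reflected position. The rest is rearrangement in an
  abelian group.\<close>

lemma degree_symmetric:
  assumes "i < n" "j < n"
  shows "inv (d i) \<otimes> d (opp i) = inv (d j) \<otimes> d (opp j)"
proof -
  have "inv (d i) \<otimes> d (opp i) = inv (d j) \<otimes> d (opp j)" if ij: "i \<le> j" "j < n" for i j
  proof -
    have i: "i < n" using ij by simp
    note D = deg_closed[OF i] deg_closed[OF ij(2)] deg_closed[of "opp i"] deg_closed[of "opp j"]
    have "star (mat_unit n i j) \<in> R (inv (inv (d i) \<otimes> d j))"
      using star_homog[OF unit_homog[OF ij]] D by simp
    moreover have "star (mat_unit n i j) $$ (opp j, opp i) \<noteq> 0"
      using coef_opp[OF ij] by (auto simp: coef_def)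
    ultimately have "inv (d (opp j)) \<otimes> d (opp i) = inv (inv (d i) \<otimes> d j)"
      using homog_degree[of "star (mat_unit n i j)" _ "opp j" "opp i"] D i ij by simp
    then have "inv (d (opp j)) \<otimes> d (opp i) = inv (d j) \<otimes> d i"
      using D i ij by (simp add: inv_mult_group)
    then have "d (opp i) = d (opp j) \<otimes> (inv (d j) \<otimes> d i)"
      using D i ij inv_solve_left[of "inv (d j) \<otimes> d i" "d (opp j)" "d (opp i)"] by simp
    moreover have "inv (d i) \<otimes> (d (opp j) \<otimes> (inv (d j) \<otimes> d i)) =
        (inv (d i) \<otimes> d i) \<otimes> (inv (d j) \<otimes> d (opp j))"
      using D i ij m_assoc[of "d i" "inv (d i)"] by (simp add: m_ac) (simp add: m_assoc[symmetric])
    ultimately show ?thesis using D i ij by simp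
  qed
  from this[of i j] this[of j i, symmetric] assms show ?thesis by linarith
qed

text \<open>Conjugation with the diagonal matrix of \<open>q\<close> multiplies the potential at
  \<open>i\<close> by \<open>q i * q (opp i)\<close>. Diagonal matrices have degree
  \<open>\<one>\<close>, so \<open>d\<close> is kept.\<close>

lemma rescale:
  assumes nz: "\<And>i. i < n \<Longrightarrow> q i \<noteq> 0"
  obtains R' star' \<phi> where "elementary_UT G n R' star' d" "UT_graded_star_iso G n R star R' star' \<phi>"
    "\<And>A. A \<in> UT n \<Longrightarrow> star' A \<in> UT n"
    "\<And>A i j. A \<in> UT n \<Longrightarrow> i \<le> j \<Longrightarrow> j < n \<Longrightarrow> star' A $$ (opp j, opp i) =
      (q j * q (opp j) * weight j) / (q i * q (opp i) * weight i) * A $$ (i,j)"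
proof -
  let ?D = "mat_diag n q" and ?E = "mat_diag n (\<lambda>i. inverse (q i))"
  have U: "?D \<in> UT n" "?E \<in> UT n" by (auto simp: UT_iff mat_diag_def)
  have DR: "?D \<in> R \<one>" "?E \<in> R \<one>"
    using U deg_closed by (auto simp: homog_iff mat_diag_def)
  have inv: "?D * ?E = 1\<^sub>m n" "?E * ?D = 1\<^sub>m n"
    unfolding mat_diag_diag by (rule eq_matI, auto simp: mat_diag_def nz)+
  let ?star = "\<lambda>A. ?D * (star (?E * (A * ?D)) * ?E)"
  have "?star A $$ (opp j, opp i) =
      (q j * q (opp j) * weight j) / (q i * q (opp i) * weight i) * A $$ (i,j)"
    if A: "A \<in> UT n" and ij: "i \<le> j" "j < n" for A i j
  proof -
    let ?B = "?E * (A * ?D)"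
    have i: "i < n" using ij by simp
    have AD: "A * ?D \<in> UT n" using UT_mult[OF A U(1)] .
    have B: "?B \<in> UT n" using UT_mult[OF U(2) AD] .
    have sB: "star ?B \<in> UT n" using star_UT[OF B] .
    have sBE: "star ?B * ?E \<in> UT n" using UT_mult[OF sB U(2)] .
    have "?B $$ (i,j) = inverse (q i) * (A $$ (i,j) * q j)"
      using i ij UT_carrier[OF A]
      by (simp add: mat_diag_mult_left[of _ n n] mat_diag_mult_right[of _ n n])
    moreover have "?star A $$ (opp j, opp i) = q (opp j) * (star ?B $$ (opp j, opp i) * inverse (q (opp i)))"
      using i ij UT_carrier[OF sB]
      by (simp add: mat_diag_mult_left[of _ n n] mat_diag_mult_right[of _ n n])
    ultimately show ?thesis
      using star_index[OF B ij] coef_eq[OF ij] by (simp add: divide_inverse mult_ac)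
  qed
  moreover have "?star A \<in> UT n" if "A \<in> UT n" for A
    by (intro UT_mult U star_UT that)
  ultimately show thesis
    by (intro that[OF conj_degree_one[OF DR inv]])
qed

end

lemma reversing_canonical:
  fixes G :: "('g, 'm) monoid_scheme" and R :: "'g \<Rightarrow> 'a::{alg_closed_field, field_char_0} mat set"
  assumes "reversing_UT G n R star d"
  shows "\<exists>R' star' \<phi>. elementary_UT G n R' star' d \<and> UT_graded_star_iso G n R star R' star' \<phi> \<and>
    ((\<forall>A\<in>UT n. star' A = inv_circ n A) \<or> (even n \<and> (\<forall>A\<in>UT n. star' A = inv_s (n div 2) A)))"
proof -
  interpret reversing_UT G n R star d by fact
  show ?thesis
  proof (cases "\<forall>i<n. weight (opp i) = weight i")
    case True
    \<comment> \<open>Choosing roots by a function gives equal weights equal roots. Hence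
      \<open>q i * q (opp i)\<close> inverts \<open>weight i\<close>, uniformly including a middle
      index \<open>i = opp i\<close>.\<close>
    obtain r :: "'a \<Rightarrow> 'a" where r: "r x ^ 2 = x" for x
      using nth_root_exists[of 2] by (metis zero_less_numeral)
    define q where "q i = inverse (r (weight i))" for i
    have r0: "r (weight i) \<noteq> 0" if "i < n" for i
      using r[of "weight i"] weight_nonzero[OF that] by auto
    then have "q i \<noteq> 0" if "i < n" for i using that by (simp add: q_def)
    from rescale[of q, OF this] obtain R' star' \<phi> where
      R': "elementary_UT G n R' star' d" "UT_graded_star_iso G n R star R' star' \<phi>"
      and U: "\<And>A. A \<in> UT n \<Longrightarrow> star' A \<in> UT n"
      and idx: "\<And>A i j. A \<in> UT n \<Longrightarrow> i \<le> j \<Longrightarrow> j < n \<Longrightarrow> star' A $$ (opp j, opp i) =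
        (q j * q (opp j) * weight j) / (q i * q (opp i) * weight i) * A $$ (i,j)"
      by metis
    have "q i * q (opp i) * weight i = 1" if "i < n" for i
      using True that r[of "weight i"] r0[OF that] weight_nonzero[OF that] by (simp add: q_def field_simps power2_eq_square)
    then have "star' A = inv_circ n A" if A: "A \<in> UT n" for A
    proof (intro UT_eqI[OF U[OF A] inv_circ_UT[OF A]])
      fix i j assume ij: "i \<le> j" "j < n"
      then show "star' A $$ (i,j) = inv_circ n A $$ (i,j)"
        using idx[OF A, of "opp j" "opp i"] inv_circ_index[OF UT_carrier[OF A], of i j]
          \<open>\<And>i. i < n \<Longrightarrow> q i * q (opp i) * weight i = 1\<close>[of "opp j"]
          \<open>\<And>i. i < n \<Longrightarrow> q i * q (opp i) * weight i = 1\<close>[of "opp i"] by simp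
    qed
    then show ?thesis using R' by blast
  next
    case False
    then obtain k where k: "k < n" "weight (opp k) \<noteq> weight k" by blast
    have "weight (opp k) ^ 2 = weight k ^ 2"
      using weight_opp[of k "opp k"] k by (simp add: power2_eq_square)
    then have "weight (opp k) = - weight k" using k by (simp add: power2_eq_iff)
    \<comment> \<open>The sign found at \<open>k\<close> is the sign at every index, as the ratio is
      constant.\<close>
    then have anti: "weight (opp i) = - weight i" if "i < n" for i
      using weight_opp[OF k(1) that] weight_nonzero[OF k(1)] by (simp add: field_simps)
        (metis mult_minus_left mult_left_cancel mult.commute)
    \<comment> \<open>For odd \<open>n\<close> the middle index is its own opposite, and its nonzero
      weight would equal its negative.\<close>
    have "even n"
    proof (rule ccontr)
      assume "odd n"
      then have "opp (n div 2) = n div 2" "n div 2 < n" by presburger+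
      then show False using anti[of "n div 2"] weight_nonzero[of "n div 2"] by simp
    qed
    then obtain m where n: "n = 2 * m" by blast
    \<comment> \<open>\<open>opp\<close> exchanges the two halves of the indices, so
      \<open>q i * q (opp i)\<close> inverts \<open>weight i\<close> on the first half and
      \<open>weight (opp i) = - weight i\<close> on the second. The new potential is the diagonal of
      \<open>sign_mat m\<close>.\<close>
    define q where "q i = (if i < m then inverse (weight i) else 1)" for i
    have "q i \<noteq> 0" if "i < n" for i using that weight_nonzero by (simp add: q_def)
    from rescale[of q, OF this] obtain R' star' \<phi> where
      R': "elementary_UT G n R' star' d" "UT_graded_star_iso G n R star R' star' \<phi>"
      and U: "\<And>A. A \<in> UT n \<Longrightarrow> star' A \<in> UT n"
      and idx: "\<And>A i j. A \<in> UT n \<Longrightarrow> i \<le> j \<Longrightarrow> j < n \<Longrightarrow> star' A $$ (opp j, opp i) =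
        (q j * q (opp j) * weight j) / (q i * q (opp i) * weight i) * A $$ (i,j)"
      by metis
    have q: "q i * q (opp i) * weight i = (if i < m then 1 else - 1)" if "i < n" for i
      using that anti[OF that] weight_nonzero[OF that] by (auto simp: q_def n field_simps)
    have "star' A = inv_s m A" if A: "A \<in> UT n" for A
    proof (rule UT_eqI[OF U[OF A] inv_s_UT[OF A[unfolded n], folded n]])
      fix i j assume ij: "i \<le> j" "j < n"
      then have "i < n" by simp
      \<comment> \<open>The quotient involves the signs at \<open>opp i\<close> and
        \<open>opp j\<close>; reflection flips both, which leaves the product of the signs at
        \<open>i\<close> and \<open>j\<close>.\<close>
      then show "star' A $$ (i,j) = inv_s m A $$ (i,j)"
        using idx[OF A, of "opp j" "opp i"] q[of "opp j"] q[of "opp i"] ij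
          inv_s_index[OF UT_carrier[OF A[unfolded n]], of i j] by (auto simp: n)
    qed
    then show ?thesis using R' \<open>even n\<close> n by auto
  qed
qed

theorem corollary5p11:
  fixes G :: "('g, 'm) monoid_scheme" and n :: nat
    and R :: "'g \<Rightarrow> 'a::{alg_closed_field, field_char_0} mat set"
    and star :: "'a mat \<Rightarrow> 'a mat"
  assumes "comm_group G" and "finite (carrier G)"
    and "UT_grading G n R"
    and "UT_involution n star"
    and "degree_inverting G R star"
  shows "\<exists>g R' star' \<phi>.
    (\<forall>i<n. g i \<in> carrier G) \<and>
    (\<forall>i<n. \<forall>j<n. inv\<^bsub>G\<^esub> (g i) \<otimes>\<^bsub>G\<^esub> g (n - 1 - i) = inv\<^bsub>G\<^esub> (g j) \<otimes>\<^bsub>G\<^esub> g (n - 1 - j)) \<and>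
    elementary_grading G n g R' \<and>
    (star' = inv_circ n \<or> (even n \<and> star' = inv_s (n div 2))) \<and>
    UT_graded_star_iso G n R star R' star' \<phi>"
proof -
  have "graded_star_UT G n R star"
    by (rule graded_star_UT.intro[OF graded_UT.intro[OF assms(1) graded_UT_axioms.intro[OF assms(2,3)]]
      graded_star_UT_axioms.intro[OF assms(4,5)]])
  from graded_star_UT.isomorphic_elementary[OF this] obtain R1 s1 d \<phi>1 where
    1: "elementary_UT G n R1 s1 d" "UT_graded_star_iso G n R star R1 s1 \<phi>1" by blast
  from isomorphic_reversing[OF 1(1)] obtain R2 s2 \<phi>2 where
    2: "elementary_UT G n R2 s2 d" "UT_graded_star_iso G n R1 s1 R2 s2 \<phi>2"
    and "\<forall>k<n. s2 (mat_unit n k k) = mat_unit n (n - 1 - k) (n - 1 - k)" by blast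
  then have rev: "reversing_UT G n R2 s2 d"
    by (intro reversing_UT.intro reversing_UT_axioms.intro) auto
  from reversing_canonical[OF this] obtain R3 s3 \<phi>3 where
    3: "elementary_UT G n R3 s3 d" "UT_graded_star_iso G n R2 s2 R3 s3 \<phi>3"
    and s3: "(\<forall>A\<in>UT n. s3 A = inv_circ n A) \<or> (even n \<and> (\<forall>A\<in>UT n. s3 A = inv_s (n div 2) A))" by blast
  \<comment> \<open>\<open>s3\<close> is known only on \<open>UT n\<close>, whereas the conclusion
    is an equality of functions. Replacing it is harmless because the isomorphism has values in
    \<open>UT n\<close>.\<close>
  obtain star' where star': "star' = inv_circ n \<or> (even n \<and> star' = inv_s (n div 2))"
    and eq: "\<forall>A\<in>UT n. s3 A = star' A"
    using s3 by blast
  note iso = UT_graded_star_iso_trans[OF UT_graded_star_iso_trans[OF 1(2) 2(2)] 3(2)]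
  then have "s3 ((\<phi>3 \<circ> (\<phi>2 \<circ> \<phi>1)) A) = star' ((\<phi>3 \<circ> (\<phi>2 \<circ> \<phi>1)) A)" if "A \<in> UT n" for A
    using eq that unfolding UT_graded_star_iso_def by (blast dest: bij_betwE)
  with iso have "UT_graded_star_iso G n R star R3 star' (\<phi>3 \<circ> (\<phi>2 \<circ> \<phi>1))"
    unfolding UT_graded_star_iso_def by simp
  moreover have "\<forall>i<n. d i \<in> carrier G"
    using elementary_UT.deg_closed[OF 3(1)] by blast
  \<comment> \<open>The symmetry is taken from the stage before rescaling, which has the same tuple
    \<open>d\<close>.\<close>
  moreover have "\<forall>i<n. \<forall>j<n. inv\<^bsub>G\<^esub> (d i) \<otimes>\<^bsub>G\<^esub> d (n - 1 - i) = inv\<^bsub>G\<^esub> (d j) \<otimes>\<^bsub>G\<^esub> d (n - 1 - j)"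
    using reversing_UT.degree_symmetric[OF rev] by blast
  moreover note elementary_UT.elementary[OF 3(1)] star'
  ultimately show ?thesis
    by (intro exI[of _ d] exI[of _ R3] exI[of _ star'] exI[of _ "\<phi>3 \<circ> (\<phi>2 \<circ> \<phi>1)"] conjI)
qed

end
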